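(* Let $X$ be a Banach space. The following assertions are equivalent. (1) There is a locally convex topology $\tau$ on $X^*$ such that $\text{(I)-env}(A)=\overline{\operatorname{conv} A}^{\tau}$ for each $A\subset X^*$. (2) $\text{(I)-env}(A)=\overline{\operatorname{conv} A}^{\sigma(X^*,B_1(X))}$ for each $A\subset X^*$.
   Context: Banach spaces are real or complex. For a Banach space $X$ and $A\subset X^*$, the (I)-envelope of $A$ is $$\text{(I)-env}(A)= \bigcap\left\{\overline{\operatorname{conv}\bigcup_{n=1}^\infty \overline{\operatorname{conv} A_n}^{w^*}}^{\|\cdot\|} : A=\bigcup_{n=1}^\infty A_n\right\},$$ the intersection being over all countable covers $A=\bigcup_n A_n$ by subsets of $A$. Here $\operatorname{conv}$ is the convex hull. Further, $B_1(X)=\{x^{**}\in X^{**} : \text{there is a sequence } (x_n) \text{ in } X \text{ with } x_n\to x^{**} \text{ in the weak}^*\text{ topology of } X^{**}\}$. For a linear subspace $Z\subset X^{**}$, $\sigma(X^*,Z)$ is the weakest topology on $X^*$ making all elements of $Z$ continuous. $\overline{A}^{\tau}$ denotes the closure of $A$ in the topology $\tau$. A locally convex topology is a vector space topology having a base of neighborhoods of zero consisting of convex sets. *)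

theory Defs
  imports "HOL-Analysis.Analysis"
begin

text \<open>
  The class \<open>banach\<close> only knows real scalars. A Banach space over a field \<open>'k\<close> (which will be
  \<open>real\<close> or \<open>complex\<close>) is therefore a type of class \<open>banach\<close> together with a scalar
  multiplication by elements of \<open>'k\<close> that extends the real one and is compatible with the norm.
  For \<open>'k = real\<close> the only such multiplication is \<open>(*\<^sub>R)\<close>.
\<close>

locale banach_space_over = vector_space scl
  for scl :: "'k::real_normed_field \<Rightarrow> 'a::banach \<Rightarrow> 'a" +
  assumes norm_scl: "norm (scl c x) = norm c * norm x"
    and scl_of_real: "scl (of_real r) x = r *\<^sub>R x"

lemma banach_space_over_scaleR: "banach_space_over ((*\<^sub>R) :: real \<Rightarrow> 'a::banach \<Rightarrow> 'a)"
  by unfold_locales (simp_all add: scaleR_add_right scaleR_add_left)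

text \<open>
  \<open>X\<^sup>*\<close> is the set of \<open>'k\<close>-linear elements of \<open>'a \<Rightarrow>\<^sub>L 'k\<close> (all of it if \<open>'k = real\<close>);
  the norm of \<open>'a \<Rightarrow>\<^sub>L 'k\<close> is the dual norm on it.
\<close>

definition dual_space ::
    "('k::real_normed_field \<Rightarrow> 'a::banach \<Rightarrow> 'a) \<Rightarrow> ('a \<Rightarrow>\<^sub>L 'k) set" where
  "dual_space scl = {f. \<forall>c x. blinfun_apply f (scl c x) = c * blinfun_apply f x}"

definition dual_scale ::
    "'k::real_normed_field \<Rightarrow> ('a::banach \<Rightarrow>\<^sub>L 'k) \<Rightarrow> ('a \<Rightarrow>\<^sub>L 'k)" where
  "dual_scale c f = blinfun_mult_right c o\<^sub>L f"

text \<open>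
  Elements of \<open>X\<^sup>*\<^sup>*\<close> are functions on \<open>X\<^sup>*\<close>, hence extensional outside that carrier.
\<close>

definition bidual_space ::
    "('k::real_normed_field \<Rightarrow> 'a::banach \<Rightarrow> 'a) \<Rightarrow> (('a \<Rightarrow>\<^sub>L 'k) \<Rightarrow> 'k) set" where
  "bidual_space scl = {\<phi> \<in> extensional (dual_space scl).
     (\<forall>f\<in>dual_space scl. \<forall>g\<in>dual_space scl. \<phi> (f + g) = \<phi> f + \<phi> g) \<and>
     (\<forall>c. \<forall>f\<in>dual_space scl. \<phi> (dual_scale c f) = c * \<phi> f) \<and>
     (\<exists>C. \<forall>f\<in>dual_space scl. norm (\<phi> f) \<le> C * norm f)}"

definition canonical_embedding ::
    "('k::real_normed_field \<Rightarrow> 'a::banach \<Rightarrow> 'a) \<Rightarrow> 'a \<Rightarrow> (('a \<Rightarrow>\<^sub>L 'k) \<Rightarrow> 'k)" where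
  "canonical_embedding scl x = (\<lambda>f\<in>dual_space scl. blinfun_apply f x)"

text \<open>
  The weakest topology on \<open>D\<close> making all members of \<open>F\<close> continuous. Inserting \<open>D\<close> into the
  subbase ensures that the underlying set is \<open>D\<close> also when \<open>F\<close> is empty.
\<close>

definition initial_topology :: "'b set \<Rightarrow> ('b \<Rightarrow> 'k::topological_space) set \<Rightarrow> 'b topology" where
  "initial_topology D F =
     topology_generated_by (insert D {{f \<in> D. \<phi> f \<in> U} | \<phi> U. \<phi> \<in> F \<and> open U})"

lemma topspace_initial_topology [simp]: "topspace (initial_topology D F) = D"
  by (auto simp: initial_topology_def topology_generated_by_topspace)

definition sigma_dual ::
    "('k::real_normed_field \<Rightarrow> 'a::banach \<Rightarrow> 'a) \<Rightarrow> (('a \<Rightarrow>\<^sub>L 'k) \<Rightarrow> 'k) set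
       \<Rightarrow> ('a \<Rightarrow>\<^sub>L 'k) topology" where
  "sigma_dual scl Z = initial_topology (dual_space scl) Z"

definition weak_star_dual ::
    "('k::real_normed_field \<Rightarrow> 'a::banach \<Rightarrow> 'a) \<Rightarrow> ('a \<Rightarrow>\<^sub>L 'k) topology" where
  "weak_star_dual scl = sigma_dual scl (range (canonical_embedding scl))"

definition weak_star_bidual ::
    "('k::real_normed_field \<Rightarrow> 'a::banach \<Rightarrow> 'a) \<Rightarrow> (('a \<Rightarrow>\<^sub>L 'k) \<Rightarrow> 'k) topology" where
  "weak_star_bidual scl =
     initial_topology (bidual_space scl) ((\<lambda>f \<phi>. \<phi> f) ` dual_space scl)"

definition B1 ::
    "('k::real_normed_field \<Rightarrow> 'a::banach \<Rightarrow> 'a) \<Rightarrow> (('a \<Rightarrow>\<^sub>L 'k) \<Rightarrow> 'k) set" where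
  "B1 scl = {\<phi> \<in> bidual_space scl. \<exists>x :: nat \<Rightarrow> 'a.
     limitin (weak_star_bidual scl) (\<lambda>n. canonical_embedding scl (x n)) \<phi> sequentially}"

text \<open>
  The closure in the norm of \<open>'a \<Rightarrow>\<^sub>L 'k\<close> is the closure in \<open>X\<^sup>*\<close>, since \<open>X\<^sup>*\<close> is norm closed.
\<close>

definition I_env ::
    "('k::real_normed_field \<Rightarrow> 'a::banach \<Rightarrow> 'a) \<Rightarrow> ('a \<Rightarrow>\<^sub>L 'k) set \<Rightarrow> ('a \<Rightarrow>\<^sub>L 'k) set" where
  "I_env scl A =
     \<Inter> {closure (convex hull (\<Union>n. weak_star_dual scl closure_of (convex hull (As n)))) |
          As :: nat \<Rightarrow> ('a \<Rightarrow>\<^sub>L 'k) set. A = (\<Union>n. As n)}"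

text \<open>
  No separation axiom is part of this definition. Scalar multiplication is jointly continuous
  with respect to the scalar field \<open>'k\<close>.
\<close>

definition locally_convex_topology_on_dual ::
    "('k::real_normed_field \<Rightarrow> 'a::banach \<Rightarrow> 'a) \<Rightarrow> ('a \<Rightarrow>\<^sub>L 'k) topology \<Rightarrow> bool" where
  "locally_convex_topology_on_dual scl \<tau> \<longleftrightarrow>
     topspace \<tau> = dual_space scl \<and>
     continuous_map (prod_topology \<tau> \<tau>) \<tau> (\<lambda>(f, g). f + g) \<and>
     continuous_map (prod_topology euclidean \<tau>) \<tau> (\<lambda>(c, f). dual_scale c f) \<and>
     (\<forall>U. openin \<tau> U \<and> 0 \<in> U \<longrightarrow>
        (\<exists>N V. openin \<tau> V \<and> 0 \<in> V \<and> V \<subseteq> N \<and> N \<subseteq> U \<and> convex N))"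

end

theory Submission
  imports Defs
begin

text \<open>
  Everything comes from comparing one topology \<open>\<tau>\<close> as in (1) with \<open>\<sigma>(X\<^sup>*, B\<^sub>1(X))\<close>: the two have
  the same continuous linear functionals, and by Hahn-Banach the closed convex hulls depend on these
  functionals only. That (2) implies (1) is the remark that an initial topology given by linear
  functionals is locally convex.

  Members of \<open>B\<^sub>1(X)\<close> are \<open>\<tau>\<close>-continuous. Let \<open>x\<^sub>n \<in> X\<close> converge weak* to \<open>\<phi>\<close> and let
  \<open>H = {f. Re \<phi> f \<le> c}\<close>. For \<open>d > c\<close> the half-space \<open>H\<close> is covered by the sets
  \<open>{f \<in> H. \<forall>k\<ge>n. Re f x\<^sub>k \<le> d}\<close>, whose weak* closed convex hulls all lie in the norm closed
  half-space \<open>{f. Re \<phi> f \<le> d}\<close>. Hence the (I)-envelope of \<open>H\<close> is \<open>H\<close>, so that \<open>H\<close> is \<open>\<tau>\<close>-closed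
  (\<open>I_env_halfspace_subset\<close>), and a functional all of whose closed half-spaces are closed is continuous.

  Conversely, if \<open>\<Phi>\<close> is linear and \<open>\<tau>\<close>-continuous, its kernel \<open>M\<close> is a \<open>\<tau>\<close>-closed subspace and
  therefore equals its (I)-envelope. Pick \<open>\<eta>\<close> with \<open>\<Phi> \<eta> = 1\<close>. Some cover \<open>M = \<Union>\<^sub>n A\<^sub>n\<close> then keeps the
  convex hull of the weak* closed convex hulls of the \<open>A\<^sub>n\<close> at a positive distance from \<open>\<eta>\<close>. Cutting
  \<open>A\<^sub>1, \<dots>, A\<^sub>n\<close> down to the ball of radius \<open>n\<close> and separating yields \<open>x\<^sub>n\<close> in the unit ball of \<open>X\<close> with
  \<open>Re f x\<^sub>n \<le> Re \<eta> x\<^sub>n - d\<close> on these sets. Each \<open>f \<in> M\<close>, together with all its multiples, satisfies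
  this for large \<open>n\<close>; so \<open>f x\<^sub>n\<close> tends to \<open>0\<close> while \<open>Re \<eta> x\<^sub>n\<close> stays above \<open>d\<close>, and \<open>x\<^sub>n / \<eta> x\<^sub>n\<close>
  converges weak* to \<open>\<Phi>\<close> (\<open>kernel_I_env_imp_B1\<close>).

  The separation needs the weak* closed convex hull of a finite union of bounded sets to lie in the
  convex hull of the individual weak* closed convex hulls (\<open>weak_star_hull_finite_UN\<close>). This is usually
  read off from the Banach-Alaoglu theorem. Here a weak* closed convex hull is described by its support
  function (\<open>weak_star_hull_iff\<close>), and both this inclusion and the separation become statements on
  linear functionals below a maximum or a sum of sublinear ones on \<open>X\<close>, which follow from
  Hahn-Banach.
\<close>

section \<open>Sublinear functionals and the Hahn-Banach theorem\<close>

text \<open>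
  Homogeneity is demanded for \<open>t > 0\<close> only; \<open>p 0 = 0\<close> follows from \<open>p (2 *\<^sub>R 0) = 2 * p 0\<close>.
\<close>
definition sublinear :: "('v::real_vector \<Rightarrow> real) \<Rightarrow> bool" where
  "sublinear p \<longleftrightarrow> (\<forall>x y. p (x + y) \<le> p x + p y) \<and> (\<forall>t>0. \<forall>x. p (t *\<^sub>R x) = t * p x)"

lemma sublinear_add: "sublinear p \<Longrightarrow> p (x + y) \<le> p x + p y"
  by (simp add: sublinear_def)

lemma sublinear_scale: "sublinear p \<Longrightarrow> 0 < t \<Longrightarrow> p (t *\<^sub>R x) = t * p x"
  by (simp add: sublinear_def)

lemma sublinear_0: "sublinear p \<Longrightarrow> p 0 = 0"
  using sublinear_scale[of p 2 0] by simp

lemma sublinear_minus: "sublinear p \<Longrightarrow> - p (- x) \<le> p x"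
  using sublinear_add[of p x "- x"] sublinear_0[of p] by simp

lemma sublinearI:
  fixes p :: "'v::real_vector \<Rightarrow> real"
  assumes add: "\<And>x y. p (x + y) \<le> p x + p y"
    and scale: "\<And>t x. 0 < t \<Longrightarrow> p (t *\<^sub>R x) \<le> t * p x"
  shows "sublinear p"
proof -
  have "t * p x \<le> p (t *\<^sub>R x)" if "0 < t" for t x
    using scale[of "1 / t" "t *\<^sub>R x"] that by (simp add: field_simps)
  then show ?thesis
    unfolding sublinear_def using add scale by (force intro: antisym)
qed

lemma sublinear_cmult: "sublinear p \<Longrightarrow> 0 \<le> c \<Longrightarrow> sublinear (\<lambda>x. c * p x)"
  unfolding sublinear_def
  by (auto simp: mult_left_mono distrib_left[symmetric])

lemma sublinear_minus_linear:
  assumes "sublinear p" "linear u" shows "sublinear (\<lambda>x. p x - u x)"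
  using assms by (simp add: sublinear_def linear_add linear_scale algebra_simps)

text \<open>
  The two infima needed below, over the half-line spanned by a point (\<open>sublinear_lower_along\<close>) and over
  the whole space (\<open>linear_le_sum_decompose\<close>), are both of this kind: \<open>W\<close> is a convex cone of parameters,
  and \<open>b\<close> only serves to keep the infimum finite.
\<close>
lemma sublinear_infimal_convolution:
  fixes p :: "'v::real_vector \<Rightarrow> real" and L :: "'w::real_vector \<Rightarrow> 'v" and w :: "'w \<Rightarrow> real"
  assumes p: "sublinear p" and L: "linear L"
    and W: "0 \<in> W" "\<And>s t. s \<in> W \<Longrightarrow> t \<in> W \<Longrightarrow> s + t \<in> W"
      "\<And>c s. 0 < c \<Longrightarrow> s \<in> W \<Longrightarrow> c *\<^sub>R s \<in> W"
    and w: "\<And>s t. s \<in> W \<Longrightarrow> t \<in> W \<Longrightarrow> w (s + t) \<le> w s + w t"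
      "\<And>c s. 0 < c \<Longrightarrow> s \<in> W \<Longrightarrow> w (c *\<^sub>R s) = c * w s"
    and lower: "\<And>x s. s \<in> W \<Longrightarrow> b x \<le> p (x + L s) + w s"
  shows "sublinear (\<lambda>x. INF s\<in>W. p (x + L s) + w s)" (is "sublinear ?r")
    and "\<And>x s. s \<in> W \<Longrightarrow> (INF s\<in>W. p (x + L s) + w s) \<le> p (x + L s) + w s"
proof -
  have bdd: "bdd_below ((\<lambda>s. p (x + L s) + w s) ` W)" for x
    using lower by (auto simp: bdd_below_def)
  show le: "\<And>x s. s \<in> W \<Longrightarrow> ?r x \<le> p (x + L s) + w s"
    using bdd by (auto intro: cINF_lower)
  have ne: "W \<noteq> {}" using W(1) by auto
  show "sublinear ?r"
  proof (rule sublinearI)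
    fix x y :: 'v
    have *: "?r (x + y) \<le> (p (x + L s) + w s) + (p (y + L t) + w t)" if "s \<in> W" "t \<in> W" for s t
    proof -
      have "?r (x + y) \<le> p ((x + L s) + (y + L t)) + w (s + t)"
        using le[of "s + t" "x + y"] W(2)[OF that] by (simp add: linear_add[OF L] algebra_simps)
      also have "\<dots> \<le> (p (x + L s) + w s) + (p (y + L t) + w t)"
        using sublinear_add[OF p, of "x + L s" "y + L t"] w(1)[OF that] by simp
      finally show ?thesis .
    qed
    have "?r (x + y) - (p (y + L t) + w t) \<le> ?r x" if "t \<in> W" for t
      by (rule cINF_greatest[OF ne]) (use *[OF _ that] in \<open>simp add: algebra_simps\<close>)
    then have "?r (x + y) - ?r x \<le> p (y + L t) + w t" if "t \<in> W" for t
      using that by (smt (verit))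
    then have "?r (x + y) - ?r x \<le> ?r y"
      by (intro cINF_greatest[OF ne]) auto
    then show "?r (x + y) \<le> ?r x + ?r y" by simp
  next
    fix t :: real and x :: 'v assume t: "0 < t"
    have "?r (t *\<^sub>R x) / t \<le> p (x + L s) + w s" if "s \<in> W" for s
    proof -
      have "?r (t *\<^sub>R x) \<le> p (t *\<^sub>R (x + L s)) + w (t *\<^sub>R s)"
        using le[OF W(3)[OF t that], of "t *\<^sub>R x"] by (simp add: linear_scale[OF L] scaleR_add_right)
      also have "\<dots> = t * (p (x + L s) + w s)"
        using sublinear_scale[OF p t] w(2)[OF t that] by (simp add: distrib_left)
      finally show ?thesis using t by (simp add: field_simps)
    qed
    then have "?r (t *\<^sub>R x) / t \<le> ?r x" by (intro cINF_greatest[OF ne]) auto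
    then show "?r (t *\<^sub>R x) \<le> t * ?r x" using t by (simp add: field_simps)
  qed
qed

text \<open>
  The inequality at \<open>t = 0\<close> gives \<open>r \<le> p\<close>, and at \<open>t = 1\<close> and \<open>x = - y\<close> it gives \<open>r (- y) \<le> - p y\<close>:
  passing from \<open>p\<close> to \<open>r\<close> makes the functional linear along \<open>y\<close> without changing its value at \<open>y\<close>.
\<close>
lemma sublinear_lower_along:
  fixes p :: "'v::real_vector \<Rightarrow> real"
  assumes p: "sublinear p"
  obtains r where "sublinear r" "\<And>x t. 0 \<le> t \<Longrightarrow> r x \<le> p (x + t *\<^sub>R y) - t * p y"
proof -
  have b: "- p (- x) \<le> p (x + s *\<^sub>R y) + (- s * p y)" if "s \<in> {0..}" for x s
  proof (cases "s = 0")
    case True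
    then show ?thesis using sublinear_minus[OF p, of x] by simp
  next
    case False
    then have "p (s *\<^sub>R y) = s * p y" using that by (auto intro: sublinear_scale[OF p])
    then show ?thesis using sublinear_add[OF p, of "x + s *\<^sub>R y" "- x"] by simp
  qed
  have L: "linear (\<lambda>t::real. t *\<^sub>R y)" by (simp add: linear_iff scaleR_add_left)
  note conv = sublinear_infimal_convolution[where p = p and L = "\<lambda>t. t *\<^sub>R y" and W = "{0..}"
      and w = "\<lambda>t. - t * p y" and b = "\<lambda>x. - p (- x)"]
  show thesis
  proof (rule that)
    show "sublinear (\<lambda>x. INF s\<in>{0..}. p (x + s *\<^sub>R y) + - s * p y)"
      by (rule conv(1)) (use p L b in \<open>auto simp: algebra_simps\<close>)
    fix x and t :: real assume t: "0 \<le> t"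
    have "(INF s\<in>{0..}. p (x + s *\<^sub>R y) + - s * p y) \<le> p (x + t *\<^sub>R y) + - t * p y"
      by (rule conv(2)) (use p L b t in \<open>auto simp: algebra_simps\<close>)
    then show "(INF s\<in>{0..}. p (x + s *\<^sub>R y) + - s * p y) \<le> p (x + t *\<^sub>R y) - t * p y" by simp
  qed
qed

text \<open>
  A functional that cannot be lowered is already linear along every direction.
\<close>
lemma minimal_sublinear_imp_linear:
  fixes q :: "'v::real_vector \<Rightarrow> real"
  assumes q: "sublinear q" and min: "\<And>r. sublinear r \<Longrightarrow> r \<le> q \<Longrightarrow> r = q"
  shows "linear q"
proof -
  have super: "q x + q y \<le> q (x + y)" for x y
  proof -
    obtain r where r: "sublinear r" "\<And>x t. 0 \<le> t \<Longrightarrow> r x \<le> q (x + t *\<^sub>R y) - t * q y"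
      using sublinear_lower_along[OF q] by blast
    have "r \<le> q" using r(2)[of 0] by (auto simp: le_fun_def)
    then have "r = q" using min r(1) by blast
    then show ?thesis using r(2)[of 1 x] by simp
  qed
  have add: "q (x + y) = q x + q y" for x y
    using super[of x y] sublinear_add[OF q, of x y] by simp
  have neg: "q (- x) = - q x" for x
    using add[of x "- x"] sublinear_0[OF q] by simp
  have "q (c *\<^sub>R x) = c * q x" for c x
  proof -
    consider "c > 0" | "c = 0" | "c < 0" by linarith
    then show ?thesis
    proof cases
      case 3
      have "q (c *\<^sub>R x) = q (- ((- c) *\<^sub>R x))" by simp
      also have "\<dots> = - ((- c) * q x)" using 3 sublinear_scale[OF q, of "- c" x] by (simp only: neg)
      finally show ?thesis by simp
    qed (simp_all add: sublinear_scale[OF q] sublinear_0[OF q])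
  qed
  with add show ?thesis by (simp add: linear_iff)
qed

text \<open>
  Zorn's lemma on the sublinear functionals below \<open>p\<close>. The pointwise infimum of a chain stays finite
  because every member \<open>q\<close> satisfies \<open>q x \<ge> - q (- x) \<ge> - p (- x)\<close>, and it is subadditive because two
  members of a chain can be replaced by the smaller one.
\<close>
theorem hahn_banach_below:
  fixes p :: "'v::real_vector \<Rightarrow> real"
  assumes p: "sublinear p"
  obtains u where "linear u" "\<And>x. u x \<le> p x"
proof -
  define A where "A = {q. sublinear q \<and> q \<le> p}"
  have "\<exists>m\<in>A. \<forall>a\<in>A. a \<le> m \<longrightarrow> a = m"
  proof (rule predicate_Zorn)
    show "partial_order_on A (relation_of (\<lambda>q r. r \<le> q) A)"
      by (rule partial_order_on_relation_ofI) auto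
    fix C assume "C \<in> Chains (relation_of (\<lambda>q r. r \<le> q) A)"
    then have sub: "\<And>q. q \<in> C \<Longrightarrow> q \<in> A" and total: "\<And>q r. q \<in> C \<Longrightarrow> r \<in> C \<Longrightarrow> q \<le> r \<or> r \<le> q"
      by (auto simp: Chains_def relation_of_def)
    show "\<exists>u\<in>A. \<forall>a\<in>C. u \<le> a"
    proof (cases "C = {}")
      case True
      then show ?thesis using p by (auto simp: A_def)
    next
      case False
      define u where "u x = (INF q\<in>C. q x)" for x
      have "- p (- x) \<le> q x" if "q \<in> C" for q x
        using sub[OF that] sublinear_minus[of q x] by (auto simp: A_def le_fun_def intro: order_trans[of _ "- q (- x)"])
      then have bdd: "bdd_below ((\<lambda>q. q x) ` C)" for x by (auto simp: bdd_below_def)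
      have le: "u x \<le> q x" if "q \<in> C" for q x
        unfolding u_def by (rule cINF_lower[OF bdd that])
      have "sublinear u"
      proof (rule sublinearI)
        fix x y
        have *: "u (x + y) \<le> q x + r y" if qr: "q \<in> C" "r \<in> C" for q r
        proof -
          obtain s where s: "s \<in> C" "s \<le> q" "s \<le> r" using total[OF qr] qr by auto
          have "u (x + y) \<le> s x + s y"
            using le[OF s(1), of "x + y"] sub[OF s(1)] sublinear_add[of s x y] by (auto simp: A_def)
          then show ?thesis using s by (meson add_mono le_funD order_trans)
        qed
        have "u (x + y) - r y \<le> u x" if "r \<in> C" for r
          unfolding u_def[of x] by (rule cINF_greatest[OF False]) (use *[OF _ that] in \<open>simp add: algebra_simps\<close>)
        then have "u (x + y) - u x \<le> r y" if "r \<in> C" for r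
          using that by (simp add: algebra_simps)
        then have "u (x + y) - u x \<le> u y"
          unfolding u_def[of y] by (intro cINF_greatest[OF False])
        then show "u (x + y) \<le> u x + u y" by simp
      next
        fix t :: real and x assume t: "0 < t"
        have "u (t *\<^sub>R x) / t \<le> q x" if "q \<in> C" for q
          using le[OF that, of "t *\<^sub>R x"] sub[OF that] t
          by (auto simp: A_def sublinear_scale field_simps)
        then have "u (t *\<^sub>R x) / t \<le> u x"
          unfolding u_def[of x] by (intro cINF_greatest[OF False])
        then show "u (t *\<^sub>R x) \<le> t * u x" using t by (simp add: field_simps)
      qed
      moreover obtain q where "q \<in> C" using False by auto
      then have "u \<le> p" using le[of q] sub[of q] unfolding A_def le_fun_def by (blast intro: order_trans)
      ultimately show ?thesis using le by (auto simp: A_def le_fun_def)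
    qed
  qed
  then obtain m where m: "sublinear m" "m \<le> p" "\<And>a. sublinear a \<Longrightarrow> a \<le> p \<Longrightarrow> a \<le> m \<Longrightarrow> a = m"
    by (auto simp: A_def)
  have "linear m"
    by (rule minimal_sublinear_imp_linear) (use m in \<open>auto intro: order_trans\<close>)
  then show thesis using that m(2) by (auto simp: le_fun_def)
qed

corollary hahn_banach_at_point:
  fixes p :: "'v::real_vector \<Rightarrow> real"
  assumes p: "sublinear p"
  obtains u where "linear u" "\<And>x. u x \<le> p x" "u z = p z"
proof -
  obtain r where r: "sublinear r" "\<And>x t. 0 \<le> t \<Longrightarrow> r x \<le> p (x + t *\<^sub>R z) - t * p z"
    using sublinear_lower_along[OF p] by blast
  obtain u where u: "linear u" "\<And>x. u x \<le> r x" using hahn_banach_below[OF r(1)] by blast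
  have le: "u x \<le> p x" for x using u(2)[of x] r(2)[of 0 x] by simp
  have "u (- z) \<le> - p z" using u(2)[of "- z"] r(2)[of 1 "- z"] sublinear_0[OF p] by simp
  then have "u z = p z" using le[of z] by (simp add: linear_neg[OF u(1)])
  with u(1) le show thesis using that by blast
qed

text \<open>
  The summand \<open>u1\<close> has to satisfy \<open>u1 \<le> p\<close> and \<open>u1 (- y) \<le> q y - u y\<close>. By subadditivity this is the
  same as lying below the infimum over \<open>y\<close> of \<open>p (x + y) + (q y - u y)\<close>, which is finite since
  \<open>u \<le> p + q\<close>.
\<close>
lemma linear_le_sum_decompose:
  fixes p q :: "'v::real_vector \<Rightarrow> real"
  assumes p: "sublinear p" and q: "sublinear q" and u: "linear u" and le: "\<And>x. u x \<le> p x + q x"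
  obtains u1 u2 where "linear u1" "linear u2" "\<And>x. u1 x \<le> p x" "\<And>x. u2 x \<le> q x"
    "\<And>x. u x = u1 x + u2 x"
proof -
  have b: "u x - q x \<le> p (x + id y) + (q y - u y)" if "y \<in> UNIV" for x y
    using le[of "x + y"] sublinear_add[OF q, of x y] by (simp add: linear_add[OF u])
  note conv = sublinear_infimal_convolution[where p = p and L = id and W = UNIV
      and w = "\<lambda>y. q y - u y" and b = "\<lambda>x. u x - q x"]
  let ?r = "\<lambda>x. INF y\<in>UNIV. p (x + id y) + (q y - u y)"
  have w: "sublinear (\<lambda>y. q y - u y)" by (rule sublinear_minus_linear[OF q u])
  have r: "sublinear ?r"
    by (rule conv(1)) (use p b sublinear_add[OF w] sublinear_scale[OF w] linear_id in auto)
  have r_le: "?r x \<le> p (x + id y) + (q y - u y)" for x y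
    by (rule conv(2)) (use p b sublinear_add[OF w] sublinear_scale[OF w] linear_id in auto)
  obtain v where v: "linear v" "\<And>x. v x \<le> ?r x" using hahn_banach_below[OF r] by blast
  show thesis
  proof (rule that[of v "\<lambda>x. u x - v x"])
    show "linear v" by fact
    show "linear (\<lambda>x. u x - v x)" by (rule linear_compose_sub[OF u v(1)])
    show "v x \<le> p x" for x
      using v(2)[of x] r_le[of x 0] sublinear_0[OF q] linear_0[OF u] by simp
    show "u x - v x \<le> q x" for x
      using v(2)[of "- x"] r_le[of "- x" x] sublinear_0[OF p] by (simp add: linear_neg[OF v(1)])
  qed simp
qed

text \<open>
  A minimax theorem with two functionals. A point \<open>x\<close> with \<open>b x < 0\<close> imposes a lower bound on \<open>t\<close>,
  a point \<open>y\<close> with \<open>a y < 0\<close> an upper bound. If two such bounds were in conflict, some positive combination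
  of \<open>x\<close> and \<open>y\<close> would make \<open>a\<close> and \<open>b\<close> negative at the same time.
\<close>
lemma sublinear_max_nonneg_imp_convex_combination:
  fixes a b :: "'v::real_vector \<Rightarrow> real"
  assumes a: "sublinear a" and b: "sublinear b" and pos: "\<And>x. 0 \<le> max (a x) (b x)"
  obtains t where "0 \<le> t" "t \<le> 1" "\<And>x. 0 \<le> t * a x + (1 - t) * b x"
proof -
  have cross: "b x * a y \<le> b y * a x" if x: "b x < 0" and y: "a y < 0" for x y
  proof (rule ccontr)
    assume "\<not> ?thesis"
    then have gt: "b y * a x < b x * a y" by simp
    have ax: "0 \<le> a x" and by0: "0 \<le> b y" using pos[of x] pos[of y] x y by auto
    \<comment> \<open>With coefficients \<open>- a y\<close> and \<open>a x\<close> the bound for \<open>a\<close> is exactly \<open>0\<close> and that for \<open>b\<close> is negative;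
      \<open>e\<close> is small enough to make the first negative and to keep the second so.\<close>
    define e where "e = (b x * a y - b y * a x) / (2 * (b y + 1))"
    have e: "0 < e" using gt by0 by (simp add: e_def)
    have half: "d / 2 < d" if "0 < d" for d :: real using that by simp
    have "b y * e \<le> (b y + 1) * e" using e by simp
    also have "\<dots> = (b x * a y - b y * a x) / 2" using by0 by (simp add: e_def field_simps)
    also have "\<dots> < b x * a y - b y * a x" by (rule half) (use gt in simp)
    finally have e2: "b y * e < b x * a y - b y * a x" .
    let ?z = "(- a y) *\<^sub>R x + (a x + e) *\<^sub>R y"
    have "a ?z \<le> (- a y) * a x + (a x + e) * a y"
      using sublinear_add[OF a] sublinear_scale[OF a, of "- a y" x] sublinear_scale[OF a, of "a x + e" y] e ax y
      by (smt (verit))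
    also have "\<dots> = e * a y" by (simp add: algebra_simps)
    also have "\<dots> < 0" using e y by (simp add: mult_pos_neg)
    finally have 1: "a ?z < 0" .
    have "b ?z \<le> (- a y) * b x + (a x + e) * b y"
      using sublinear_add[OF b] sublinear_scale[OF b, of "- a y" x] sublinear_scale[OF b, of "a x + e" y] e ax y
      by (smt (verit))
    also have "\<dots> < 0" using e2 by (simp add: algebra_simps)
    finally show False using 1 pos[of ?z] by auto
  qed
  \<comment> \<open>All lower bounds on \<open>t\<close>; the value \<open>0\<close> keeps the set nonempty and the supremum nonnegative.\<close>
  define T where "T = insert 0 {- b x / (a x - b x) | x. b x < 0}"
  have T1: "s \<le> 1" if "s \<in> T" for s
  proof -
    have "- b x / (a x - b x) \<le> 1" if "b x < 0" for x
      using that pos[of x] by (auto simp: field_simps max_def split: if_splits)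
    then show ?thesis using that by (auto simp: T_def)
  qed
  then have bdd: "bdd_above T" by (auto simp: bdd_above_def)
  show thesis
  proof (rule that[of "Sup T"])
    show "0 \<le> Sup T" by (rule cSup_upper[OF _ bdd]) (simp add: T_def)
    show le1: "Sup T \<le> 1" by (rule cSup_least) (use T1 in \<open>auto simp: T_def\<close>)
    fix x
    consider "b x < 0" | "a x < 0" | "0 \<le> a x" "0 \<le> b x" by linarith
    then show "0 \<le> Sup T * a x + (1 - Sup T) * b x"
    proof cases
      case 1
      have "0 \<le> a x" using pos[of x] 1 by auto
      moreover have "- b x / (a x - b x) \<le> Sup T" by (rule cSup_upper[OF _ bdd]) (use 1 in \<open>auto simp: T_def\<close>)
      ultimately have "- b x \<le> Sup T * (a x - b x)" using 1 by (subst (asm) pos_divide_le_eq) auto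
      then show ?thesis by (simp add: algebra_simps)
    next
      case 2
      have bx: "0 \<le> b x" using pos[of x] 2 by auto
      have "s \<le> b x / (b x - a x)" if "s \<in> T" for s
      proof -
        have "- b y / (a y - b y) \<le> b x / (b x - a x)" if "b y < 0" for y
        proof -
          have "0 < a y - b y" using pos[of y] that by auto
          moreover have "0 < b x - a x" using bx 2 by simp
          moreover have "- b y * (b x - a x) \<le> b x * (a y - b y)"
            using cross[OF that 2] by (simp add: algebra_simps)
          ultimately show ?thesis by (simp add: divide_simps mult.commute)
        qed
        then show ?thesis using that bx 2 by (auto simp: T_def)
      qed
      then have "Sup T \<le> b x / (b x - a x)" by (intro cSup_least) (auto simp: T_def)
      then have "Sup T * (b x - a x) \<le> b x" using bx 2 by (simp add: pos_le_divide_eq)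
      then show ?thesis by (simp add: algebra_simps)
    next
      case 3
      then show ?thesis using \<open>0 \<le> Sup T\<close> le1 by (intro add_nonneg_nonneg mult_nonneg_nonneg) auto
    qed
  qed
qed

text \<open>
  The dominating functional is the Minkowski gauge of \<open>G\<close>, whose value at \<open>z\<close> is at least \<open>1\<close>.
\<close>
lemma hahn_banach_absorbing_convex:
  fixes G :: "'v::real_vector set"
  assumes G: "convex G" "0 \<in> G" and absorb: "\<And>x. \<exists>t>0. t *\<^sub>R x \<in> G" and z: "z \<notin> G"
  obtains u :: "'v \<Rightarrow> real" where "linear u" "\<And>x. x \<in> G \<Longrightarrow> u x \<le> 1" "1 \<le> u z"
proof -
  define T where "T x = {t. 0 < t \<and> (1 / t) *\<^sub>R x \<in> G}" for x
  define p where "p x = Inf (T x)" for x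
  have bdd: "bdd_below (T x)" for x by (auto simp: T_def bdd_below_def intro: exI[of _ 0])
  have ne: "T x \<noteq> {}" for x
  proof -
    obtain t where "t > 0" "t *\<^sub>R x \<in> G" using absorb by blast
    then have "1 / t \<in> T x" by (simp add: T_def)
    then show ?thesis by blast
  qed
  have le: "p x \<le> t" if "t \<in> T x" for x t unfolding p_def by (rule cInf_lower[OF that bdd])
  have "sublinear p"
  proof (rule sublinearI)
    fix x y
    have *: "s + t \<in> T (x + y)" if "s \<in> T x" "t \<in> T y" for s t
    proof -
      have st: "0 < s" "0 < t" "(1 / s) *\<^sub>R x \<in> G" "(1 / t) *\<^sub>R y \<in> G" using that by (auto simp: T_def)
      have "(s / (s + t)) *\<^sub>R ((1 / s) *\<^sub>R x) + (t / (s + t)) *\<^sub>R ((1 / t) *\<^sub>R y) \<in> G"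
        using st by (intro convexD[OF G(1)]) (auto simp: add_divide_distrib[symmetric])
      then show ?thesis using st by (simp add: T_def scaleR_add_right)
    qed
    have "p (x + y) - t \<le> p x" if "t \<in> T y" for t
      unfolding p_def[of x] by (rule cInf_greatest[OF ne]) (use le[OF *[OF _ that]] in \<open>simp add: algebra_simps\<close>)
    then have "p (x + y) - p x \<le> t" if "t \<in> T y" for t using that by (simp add: algebra_simps)
    then have "p (x + y) - p x \<le> p y" unfolding p_def[of y] by (intro cInf_greatest[OF ne])
    then show "p (x + y) \<le> p x + p y" by simp
  next
    fix c :: real and x assume c: "0 < c"
    have scaled: "c * t \<in> T (c *\<^sub>R x)" if "t \<in> T x" for t using that c by (simp add: T_def)
    have "p (c *\<^sub>R x) / c \<le> t" if "t \<in> T x" for t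
      using le[OF scaled[OF that]] c by (simp add: pos_divide_le_eq mult.commute)
    then have "p (c *\<^sub>R x) / c \<le> p x" unfolding p_def[of x] by (intro cInf_greatest[OF ne])
    then show "p (c *\<^sub>R x) \<le> c * p x" using c by (simp add: field_simps)
  qed
  then obtain u where u: "linear u" "\<And>x. u x \<le> p x" "u z = p z"
    using hahn_banach_at_point by blast
  show thesis
  proof (rule that[OF u(1)])
    fix x assume "x \<in> G"
    then have "p x \<le> 1" by (intro le) (simp add: T_def)
    then show "u x \<le> 1" using u(2)[of x] by simp
  next
    have "1 \<le> t" if "t \<in> T z" for t
    proof (rule ccontr)
      assume "\<not> ?thesis"
      then have t: "0 < t" "t < 1" "(1 / t) *\<^sub>R z \<in> G" using that by (auto simp: T_def)
      have "t *\<^sub>R ((1 / t) *\<^sub>R z) + (1 - t) *\<^sub>R 0 \<in> G"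
        using t G(2) by (intro convexD[OF G(1)]) auto
      then show False using t z by simp
    qed
    then show "1 \<le> u z" unfolding u(3) p_def by (intro cInf_greatest[OF ne])
  qed
qed

section \<open>Initial topologies\<close>
lemma continuous_map_initial_topology:
  "\<phi> \<in> F \<Longrightarrow> continuous_map (initial_topology D F) euclidean \<phi>"
  unfolding continuous_map_def
  by (auto simp: initial_topology_def intro!: topology_generated_by_Basis)

lemma continuous_map_into_initial_topology:
  assumes g: "g \<in> topspace T \<rightarrow> D" and comp: "\<And>\<phi>. \<phi> \<in> F \<Longrightarrow> continuous_map T euclidean (\<lambda>x. \<phi> (g x))"
  shows "continuous_map T (initial_topology D F) g"
  unfolding initial_topology_def
proof (rule continuous_on_generated_topo)
  show "g ` topspace T \<subseteq> \<Union> (insert D {{f \<in> D. \<phi> f \<in> U} |\<phi> U. \<phi> \<in> F \<and> open U})"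
    using g by auto
  fix S assume "S \<in> insert D {{f \<in> D. \<phi> f \<in> U} |\<phi> U. \<phi> \<in> F \<and> open U}"
  then consider "S = D" | \<phi> U where "S = {f \<in> D. \<phi> f \<in> U}" "\<phi> \<in> F" "open U" by auto
  then show "openin T (g -` S \<inter> topspace T)"
  proof cases
    case 1
    then have "g -` S \<inter> topspace T = topspace T" using g by auto
    then show ?thesis by simp
  next
    case 2
    have "g -` S \<inter> topspace T = {x \<in> topspace T. \<phi> (g x) \<in> U}" using g 2(1) by auto
    then show ?thesis using openin_continuous_map_preimage[OF comp[OF 2(2)], of U] 2(3) by simp
  qed
qed

lemma limitin_initial_topology:
  "limitin (initial_topology D F) s l sequentially \<longleftrightarrow>
     l \<in> D \<and> (\<forall>\<^sub>F n in sequentially. s n \<in> D) \<and> (\<forall>\<phi>\<in>F. (\<lambda>n. \<phi> (s n)) \<longlonglongrightarrow> \<phi> l)"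
    (is "?lhs \<longleftrightarrow> ?rhs")
proof
  assume L: ?lhs
  have "\<forall>\<^sub>F n in sequentially. s n \<in> D"
    using L openin_topspace[of "initial_topology D F"] unfolding limitin_def by fastforce
  moreover have "(\<lambda>n. \<phi> (s n)) \<longlonglongrightarrow> \<phi> l" if "\<phi> \<in> F" for \<phi>
    using continuous_map_limit[OF continuous_map_initial_topology[OF that, of D] L] by (simp add: comp_def)
  ultimately show ?rhs using limitin_topspace[OF L] by simp
next
  assume R: ?rhs
  have "\<forall>\<^sub>F n in sequentially. s n \<in> U" if "openin (initial_topology D F) U" "l \<in> U" for U
    using openin_topology_generated_by[OF that(1)[unfolded initial_topology_def]] that(2)
  proof (induction rule: generate_topology_on.induct)
    case (Int a b)
    then show ?case by (simp add: eventually_conj_iff)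
  next
    case (UN K)
    then obtain k where "k \<in> K" "l \<in> k" by auto
    then show ?case using UN(2)[of k] by (auto elim: eventually_mono)
  next
    case (Basis S)
    then consider "S = D" | \<phi> U where "S = {f \<in> D. \<phi> f \<in> U}" "\<phi> \<in> F" "open U" by auto
    then show ?case
    proof cases
      case 2
      have "\<forall>\<^sub>F n in sequentially. \<phi> (s n) \<in> U"
        using R 2 Basis(2) by (intro topological_tendstoD[where l = "\<phi> l"]) auto
      then show ?thesis using R 2(1) by (auto simp: eventually_conj_iff)
    qed (use R in simp)
  qed auto
  then show ?lhs using R by (simp add: limitin_def)
qed

lemma initial_topology_nhds_zero:
  fixes F :: "('b::zero \<Rightarrow> 'k::real_normed_vector) set"
  assumes "openin (initial_topology D F) U" "0 \<in> U" and zero: "\<And>\<phi>. \<phi> \<in> F \<Longrightarrow> \<phi> 0 = 0"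
  obtains F' e where "finite F'" "F' \<subseteq> F" "0 < e" "{f \<in> D. \<forall>\<phi>\<in>F'. norm (\<phi> f) < e} \<subseteq> U"
proof -
  have "\<exists>F' e. finite F' \<and> F' \<subseteq> F \<and> 0 < e \<and> {f \<in> D. \<forall>\<phi>\<in>F'. norm (\<phi> f) < e} \<subseteq> U"
    using openin_topology_generated_by[OF assms(1)[unfolded initial_topology_def]] assms(2)
  proof (induction rule: generate_topology_on.induct)
    case (Int a b)
    obtain A d where A: "finite A" "A \<subseteq> F" "0 < d" "{f \<in> D. \<forall>\<phi>\<in>A. norm (\<phi> f) < d} \<subseteq> a" using Int by auto
    obtain B e where B: "finite B" "B \<subseteq> F" "0 < e" "{f \<in> D. \<forall>\<phi>\<in>B. norm (\<phi> f) < e} \<subseteq> b" using Int by auto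
    show ?case
      by (rule exI[of _ "A \<union> B"], rule exI[of _ "min d e"]) (use A B in auto)
  next
    case (UN K)
    then obtain k where k: "k \<in> K" "0 \<in> k" by auto
    then show ?case using UN(2)[of k] by (meson Union_upper order_trans)
  next
    case (Basis S)
    then consider "S = D" | \<phi> U where "S = {f \<in> D. \<phi> f \<in> U}" "\<phi> \<in> F" "open U" by auto
    then show ?case
    proof cases
      case 1
      then show ?thesis by (intro exI[of _ "{}"] exI[of _ 1]) auto
    next
      case 2
      then have "0 \<in> U" using Basis(2) zero[OF 2(2)] by auto
      then obtain e where "0 < e" "ball 0 e \<subseteq> U" using 2(3) openE by blast
      then show ?thesis using 2 by (intro exI[of _ "{\<phi>}"] exI[of _ e]) auto
    qed
  qed auto
  then show thesis using that by blast
qed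

section \<open>Real and complex scalars\<close>

text \<open>
  Both scalar fields are treated at once. For the complex numbers \<open>J\<close> is the imaginary unit, and
  \<open>decomp\<close> is \<open>c = Re c - \<i> Re (\<i> c)\<close>; for the reals \<open>re\<close> is the identity and \<open>J = 0\<close>, so that the
  second term disappears.
\<close>
locale real_part =
  fixes re :: "'k::real_normed_field \<Rightarrow> real" and J :: 'k
  assumes linear_re: "linear re" and re_of_real: "re (of_real r) = r"
    and abs_re_le: "\<bar>re c\<bar> \<le> norm c" and re_J: "re J = 0"
    and decomp: "c = of_real (re c) - J * of_real (re (J * c))"
    and J_cases: "J = 0 \<or> J * J = - 1"
begin

lemma continuous_re: "continuous_on UNIV re"
proof -
  have "bounded_linear re"
    by (rule bounded_linear_intro[of _ 1])
       (use linear_re abs_re_le in \<open>auto simp: linear_add linear_scale\<close>)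
  then show ?thesis by (rule linear_continuous_on)
qed

lemma re_add: "re (a + b) = re a + re b"
  and re_diff: "re (a - b) = re a - re b"
  and re_zero: "re 0 = 0"
  and re_minus: "re (- a) = - re a"
  using linear_re by (auto simp: linear_add linear_diff linear_0 linear_neg)

lemma re_of_real_mult: "re (of_real r * c) = r * re c"
  using linear_scale[OF linear_re, of r c] by (simp add: scaleR_conv_of_real)

text \<open>
  The scalar-linear functional with real part \<open>u\<close>. It is used for \<open>X\<close> and for \<open>X\<^sup>*\<close>, hence the
  explicit scalar multiplication \<open>s\<close>.
\<close>
definition extend :: "('k \<Rightarrow> 'v \<Rightarrow> 'v) \<Rightarrow> ('v::real_vector \<Rightarrow> real) \<Rightarrow> 'v \<Rightarrow> 'k" where
  "extend s u x = of_real (u x) - J * of_real (u (s J x))"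

lemma
  assumes s: "vector_space s" and s_of_real: "\<And>r x. s (of_real r) x = r *\<^sub>R x" and u: "linear u"
  shows extend_add: "extend s u (x + y) = extend s u x + extend s u y"
    and extend_scale: "extend s u (s c x) = c * extend s u x"
    and re_extend: "re (extend s u x) = u x"
proof -
  interpret V: vector_space s by fact
  show add: "extend s u (x + y) = extend s u x + extend s u y" for x y
    by (simp add: extend_def V.scale_right_distrib linear_add[OF u] algebra_simps)
  have commute: "s c (r *\<^sub>R x) = r *\<^sub>R s c x" for c r x
    using V.scale_left_commute[of c "of_real r" x] unfolding s_of_real .
  have real: "extend s u (r *\<^sub>R x) = of_real r * extend s u x" for r x
    by (simp add: extend_def commute linear_scale[OF u] algebra_simps)
  have imag: "extend s u (s J x) = J * extend s u x" for x
    using J_cases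
  proof
    assume "J = 0"
    then show ?thesis unfolding extend_def by (simp add: linear_0[OF u])
  next
    assume J: "J * J = - 1"
    have "s J (s J x) = - x" by (simp add: J)
    moreover have "J * (J * a) = - a" for a using J by (simp add: mult.assoc[symmetric])
    ultimately show ?thesis by (simp add: extend_def linear_neg[OF u] right_diff_distrib)
  qed
  define a b where "a = re c" and "b = - re (J * c)"
  have c: "c = of_real a + of_real b * J" using decomp[of c] by (simp add: a_def b_def mult.commute)
  have "s c x = a *\<^sub>R x + b *\<^sub>R s J x"
    unfolding c V.scale_left_distrib V.scale_scale[symmetric] s_of_real ..
  then show "extend s u (s c x) = c * extend s u x"
    by (simp add: add real imag c algebra_simps)
  show "re (extend s u x) = u x"
    using re_of_real_mult[of _ J] by (simp add: extend_def re_diff re_of_real re_J mult.commute)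
qed

end

section \<open>The dual as a locally convex space\<close>

locale scalar_banach = banach_space_over scl + real_part re J
  for scl :: "'k::real_normed_field \<Rightarrow> 'a::banach \<Rightarrow> 'a" and re :: "'k \<Rightarrow> real" and J :: 'k
begin

abbreviation D :: "('a \<Rightarrow>\<^sub>L 'k) set" where "D \<equiv> dual_space scl"

lemma dual_iff: "f \<in> D \<longleftrightarrow> (\<forall>c x. f (scl c x) = c * f x)"
  by (simp add: dual_space_def)

lemma dual_scale_apply [simp]: "blinfun_apply (dual_scale c f) x = c * f x"
  by (simp add: dual_scale_def)

lemma dual_scale_of_real [simp]: "dual_scale (of_real r) f = r *\<^sub>R (f :: 'a \<Rightarrow>\<^sub>L 'k)"
  by (rule blinfun_eqI) (simp add: blinfun.scaleR_left scaleR_conv_of_real)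

lemma vector_space_dual_scale: "vector_space (dual_scale :: 'k \<Rightarrow> ('a \<Rightarrow>\<^sub>L 'k) \<Rightarrow> _)"
  by unfold_locales (auto intro!: blinfun_eqI simp: blinfun.add_left algebra_simps)

lemma dual_scale_in_dual: "f \<in> D \<Longrightarrow> dual_scale c f \<in> D"
  by (simp add: dual_iff algebra_simps)

lemma subspace_dual: "real_vector.subspace D"
  by (auto simp: real_vector.subspace_def dual_iff blinfun.add_left blinfun.scaleR_left algebra_simps)

lemmas zero_in_dual = real_vector.subspace_0[OF subspace_dual]
  and add_in_dual = real_vector.subspace_add[OF subspace_dual]
  and diff_in_dual = real_vector.subspace_diff[OF subspace_dual]
  and scaleR_in_dual = real_vector.subspace_scale[OF subspace_dual]

lemma closed_dual: "closed D"
proof -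
  have "D = (\<Inter>c. \<Inter>x. {f. blinfun_apply f (scl c x) = c * blinfun_apply f x})"
    by (auto simp: dual_iff)
  moreover have "closed {f :: 'a \<Rightarrow>\<^sub>L 'k. blinfun_apply f (scl c x) = c * blinfun_apply f x}" for c x
    by (intro closed_Collect_eq continuous_intros)
  ultimately show ?thesis by (simp add: closed_INT)
qed

definition dual_linear :: "(('a \<Rightarrow>\<^sub>L 'k) \<Rightarrow> 'k) \<Rightarrow> bool" where
  "dual_linear \<Phi> \<longleftrightarrow> (\<forall>f\<in>D. \<forall>g\<in>D. \<Phi> (f + g) = \<Phi> f + \<Phi> g) \<and> (\<forall>c. \<forall>f\<in>D. \<Phi> (dual_scale c f) = c * \<Phi> f)"

lemma
  assumes "dual_linear \<Phi>"
  shows dual_linear_add: "f \<in> D \<Longrightarrow> g \<in> D \<Longrightarrow> \<Phi> (f + g) = \<Phi> f + \<Phi> g"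
    and dual_linear_scale: "f \<in> D \<Longrightarrow> \<Phi> (dual_scale c f) = c * \<Phi> f"
    and dual_linear_scaleR: "f \<in> D \<Longrightarrow> \<Phi> (r *\<^sub>R f) = of_real r * \<Phi> f"
    and dual_linear_0: "\<Phi> 0 = 0"
    and dual_linear_diff: "f \<in> D \<Longrightarrow> g \<in> D \<Longrightarrow> \<Phi> (f - g) = \<Phi> f - \<Phi> g"
proof -
  show add: "\<Phi> (f + g) = \<Phi> f + \<Phi> g" if "f \<in> D" "g \<in> D" for f g using assms that by (simp add: dual_linear_def)
  show scale: "\<Phi> (dual_scale c f) = c * \<Phi> f" if "f \<in> D" for c f using assms that by (simp add: dual_linear_def)
  show real: "\<Phi> (r *\<^sub>R f) = of_real r * \<Phi> f" if "f \<in> D" for r f using scale[OF that, of "of_real r"] by simp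
  show "\<Phi> 0 = 0" using real[of 0 0] zero_in_dual by simp
  show "\<Phi> (f - g) = \<Phi> f - \<Phi> g" if "f \<in> D" "g \<in> D"
    using add[of f "(-1) *\<^sub>R g"] real[of g "-1"] scaleR_in_dual[of g "-1"] that by simp
qed

lemma convex_dual: "convex D"
  by (rule subspace_imp_convex[OF subspace_dual])

lemma convex_halfspace_dual_linear:
  assumes "dual_linear \<Phi>" shows "convex {f \<in> D. re (\<Phi> f) \<le> c}"
proof (rule convexI)
  fix f g and s t :: real assume *: "f \<in> {f \<in> D. re (\<Phi> f) \<le> c}" "g \<in> {f \<in> D. re (\<Phi> f) \<le> c}"
    "0 \<le> s" "0 \<le> t" "s + t = 1"
  then have D: "s *\<^sub>R f + t *\<^sub>R g \<in> D" using convexD[OF convex_dual] by auto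
  have "s * re (\<Phi> f) + t * re (\<Phi> g) \<le> c" using * by (intro convex_bound_le) auto
  then show "s *\<^sub>R f + t *\<^sub>R g \<in> {f \<in> D. re (\<Phi> f) \<le> c}" using * D
    by (simp add: dual_linear_add[OF assms] dual_linear_scaleR[OF assms] scaleR_in_dual re_add re_of_real_mult)
qed

lemma locally_convex_initial_topology:
  assumes F: "\<And>\<phi>. \<phi> \<in> F \<Longrightarrow> dual_linear \<phi>"
  shows "locally_convex_topology_on_dual scl (initial_topology D F)"
  unfolding locally_convex_topology_on_dual_def
proof (intro conjI allI impI)
  let ?T = "initial_topology D F"
  have cont: "continuous_map ?T euclidean \<phi>" if "\<phi> \<in> F" for \<phi>
    using that by (rule continuous_map_initial_topology)
  show "continuous_map (prod_topology ?T ?T) ?T (\<lambda>(f, g). f + g)"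
  proof (rule continuous_map_into_initial_topology)
    show "(\<lambda>(f, g). f + g) \<in> topspace (prod_topology ?T ?T) \<rightarrow> D"
      using add_in_dual by auto
    fix \<phi> assume \<phi>: "\<phi> \<in> F"
    have "continuous_map (prod_topology ?T ?T) euclidean (\<lambda>z. \<phi> (fst z) + \<phi> (snd z))"
      using continuous_map_compose[OF continuous_map_fst cont[OF \<phi>]]
        continuous_map_compose[OF continuous_map_snd cont[OF \<phi>]]
      by (intro continuous_map_add) (simp_all add: comp_def)
    then show "continuous_map (prod_topology ?T ?T) euclidean (\<lambda>z. \<phi> (case z of (f, g) \<Rightarrow> f + g))"
      by (rule continuous_map_eq) (use dual_linear_add[OF F[OF \<phi>]] in auto)
  qed
  show "continuous_map (prod_topology euclidean ?T) ?T (\<lambda>(c, f). dual_scale c f)"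
  proof (rule continuous_map_into_initial_topology)
    show "(\<lambda>(c, f). dual_scale c f) \<in> topspace (prod_topology euclidean ?T) \<rightarrow> D"
      using dual_scale_in_dual by auto
    fix \<phi> assume \<phi>: "\<phi> \<in> F"
    have "continuous_map (prod_topology euclidean ?T) (prod_topology euclidean euclidean) (\<lambda>z. (fst z, \<phi> (snd z)))"
      using continuous_map_compose[OF continuous_map_snd cont[OF \<phi>], of euclidean]
      by (intro continuous_map_pairedI continuous_map_fst) (simp add: comp_def)
    then have "continuous_map (prod_topology euclidean ?T) euclidean (\<lambda>z. (\<lambda>(c, d). c * d) (fst z, \<phi> (snd z)))"
      by (rule continuous_map_compose[unfolded comp_def])
         (auto simp: euclidean_product_topology split_beta intro!: continuous_intros)
    then have "continuous_map (prod_topology euclidean ?T) euclidean (\<lambda>z. fst z * \<phi> (snd z))"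
      by simp
    then show "continuous_map (prod_topology euclidean ?T) euclidean (\<lambda>z. \<phi> (case z of (c, f) \<Rightarrow> dual_scale c f))"
      by (rule continuous_map_eq) (use dual_linear_scale[OF F[OF \<phi>]] in auto)
  qed
  fix U assume U: "openin ?T U \<and> 0 \<in> U"
  then obtain F' e where F': "finite F'" "F' \<subseteq> F" "0 < e" "{f \<in> D. \<forall>\<phi>\<in>F'. norm (\<phi> f) < e} \<subseteq> U"
    using initial_topology_nhds_zero[of D F U] dual_linear_0[OF F] by blast
  let ?V = "{f \<in> D. \<forall>\<phi>\<in>F'. norm (\<phi> f) < e}"
  have "openin ?T ?V"
  proof -
    have "openin ?T ({f \<in> D. norm (\<phi> f) < e})" if "\<phi> \<in> F'" for \<phi>
      using openin_continuous_map_preimage[OF cont[of \<phi>], of "ball 0 e"] that F'(2) by auto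
    then have "openin ?T ((\<Inter>\<phi>\<in>F'. {f \<in> D. norm (\<phi> f) < e}) \<inter> topspace ?T)"
      by (rule openin_INT[OF F'(1)])
    moreover have "(\<Inter>\<phi>\<in>F'. {f \<in> D. norm (\<phi> f) < e}) \<inter> topspace ?T = ?V" by auto
    ultimately show ?thesis by simp
  qed
  moreover have "convex ?V"
  proof (rule convexI)
    fix f g and s t :: real assume *: "f \<in> ?V" "g \<in> ?V" "0 \<le> s" "0 \<le> t" "s + t = 1"
    then have D: "s *\<^sub>R f + t *\<^sub>R g \<in> D" using convexD[OF convex_dual] by auto
    have "norm (\<phi> (s *\<^sub>R f + t *\<^sub>R g)) < e" if "\<phi> \<in> F'" for \<phi>
    proof -
      have \<phi>: "dual_linear \<phi>" using that F'(2) F by blast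
      have "\<phi> (s *\<^sub>R f + t *\<^sub>R g) = s *\<^sub>R \<phi> f + t *\<^sub>R \<phi> g"
        using *
        by (simp add: dual_linear_add[OF \<phi>] dual_linear_scaleR[OF \<phi>] scaleR_in_dual scaleR_conv_of_real)
      also have "\<dots> \<in> ball 0 e" using * that by (intro convexD[OF convex_ball]) auto
      finally show ?thesis by simp
    qed
    with D show "s *\<^sub>R f + t *\<^sub>R g \<in> ?V" by simp
  qed
  moreover have "0 \<in> ?V"
  proof -
    have "norm (\<phi> 0) < e" if "\<phi> \<in> F'" for \<phi> using that F'(2,3) dual_linear_0[OF F, of \<phi>] by auto
    then show ?thesis using zero_in_dual by blast
  qed
  ultimately show "\<exists>N V. openin ?T V \<and> 0 \<in> V \<and> V \<subseteq> N \<and> N \<subseteq> U \<and> convex N"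
    using F'(4) by blast
qed simp

end

text \<open>
  This transfers Hahn-Banach from the type of all bounded real-linear maps to the dual, which for
  complex scalars is a proper real subspace of it.
\<close>
lemma linear_projection_onto_subspace:
  fixes S :: "'v::real_vector set"
  assumes "subspace S"
  obtains P :: "'v \<Rightarrow> 'v" where "linear P" "\<And>x. P x \<in> S" "\<And>x. x \<in> S \<Longrightarrow> P x = x"
  using linear_exists_left_inverse_on[OF linear_id assms inj_on_id] by (auto simp: image_subset_iff)

context scalar_banach begin

lemma locally_convex_topspace: "locally_convex_topology_on_dual scl \<tau> \<Longrightarrow> topspace \<tau> = D"
  by (simp add: locally_convex_topology_on_dual_def)

lemma locally_convex_affine:
  assumes lc: "locally_convex_topology_on_dual scl \<tau>" and h: "h \<in> D"
  shows "continuous_map \<tau> \<tau> (\<lambda>f. dual_scale c f + h)"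
proof -
  have top: "topspace \<tau> = D" by (rule locally_convex_topspace[OF lc])
  have scale: "continuous_map \<tau> \<tau> (\<lambda>f. dual_scale c f)"
    using continuous_map_compose[of \<tau> "prod_topology euclidean \<tau>" "\<lambda>f. (c, f)" \<tau> "\<lambda>(c, f). dual_scale c f"] lc
    by (simp add: locally_convex_topology_on_dual_def continuous_map_pairedI comp_def)
  then have "continuous_map \<tau> (prod_topology \<tau> \<tau>) (\<lambda>f. (dual_scale c f, h))"
    using h top by (intro continuous_map_pairedI) auto
  then show ?thesis
    using continuous_map_compose[of \<tau> "prod_topology \<tau> \<tau>" "\<lambda>f. (dual_scale c f, h)" \<tau> "\<lambda>(f, g). f + g"] lc
    by (simp add: locally_convex_topology_on_dual_def comp_def)
qed

lemma locally_convex_affine_preimage: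
  assumes "locally_convex_topology_on_dual scl \<tau>" "h \<in> D" "openin \<tau> U"
  shows "openin \<tau> {f \<in> D. r *\<^sub>R f + h \<in> U}"
  using openin_continuous_map_preimage[OF locally_convex_affine[OF assms(1,2), of "of_real r"] assms(3)]
    locally_convex_topspace[OF assms(1)] by simp

lemma locally_convex_absorbing:
  assumes lc: "locally_convex_topology_on_dual scl \<tau>" and U: "openin \<tau> U" "0 \<in> U" and f: "f \<in> D"
  obtains t :: real where "0 < t" "t *\<^sub>R f \<in> U"
proof -
  have "continuous_map euclideanreal (prod_topology euclidean \<tau>) (\<lambda>t. (of_real t :: 'k, f))"
    using f locally_convex_topspace[OF lc]
    by (intro continuous_map_pairedI) (auto intro!: continuous_intros)
  then have "continuous_map euclideanreal \<tau> (\<lambda>t. t *\<^sub>R f)"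
    using continuous_map_compose[of euclideanreal "prod_topology euclidean \<tau>" "\<lambda>t. (of_real t :: 'k, f)" \<tau>
        "\<lambda>(c, f). dual_scale c f"] lc
    by (simp add: locally_convex_topology_on_dual_def comp_def)
  then have "open {t::real. t *\<^sub>R f \<in> U}"
    using openin_continuous_map_preimage[OF _ U(1), of euclideanreal "\<lambda>t. t *\<^sub>R f"] by simp
  moreover have "0 \<in> {t::real. t *\<^sub>R f \<in> U}" using U(2) by simp
  ultimately obtain e where e: "0 < e" "cball 0 e \<subseteq> {t::real. t *\<^sub>R f \<in> U}"
    unfolding open_contains_cball by blast
  then have "e *\<^sub>R f \<in> U" by (auto simp: subset_iff)
  then show thesis using that e(1) by blast
qed

text \<open>
  Hahn-Banach separation on the dual. A bound on a neighbourhood \<open>V\<close> of zero is recorded in place of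
  continuity: it gives continuity in general, and in the weak* topology it also shows that \<open>\<phi>\<close> is an evaluation.
\<close>
lemma separation_from_closed_convex_hull:
  assumes lc: "locally_convex_topology_on_dual scl \<tau>" and A: "A \<subseteq> D" "A \<noteq> {}"
    and \<eta>: "\<eta> \<in> D" "\<eta> \<notin> \<tau> closure_of (convex hull A)"
  obtains \<phi> V e where "linear \<phi>" "openin \<tau> V" "0 \<in> V" "\<And>v. v \<in> V \<Longrightarrow> \<phi> v \<le> (1::real)"
    "0 < e" "\<And>a. a \<in> A \<Longrightarrow> \<phi> a + e \<le> \<phi> \<eta>"
proof -
  let ?C = "convex hull A"
  have CD: "?C \<subseteq> D" by (rule hull_minimal[where S = convex, OF A(1) convex_dual])
  obtain a where a: "a \<in> A" using A(2) by blast
  then have aC: "a \<in> ?C" by (simp add: hull_inc)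
  obtain U where U: "openin \<tau> U" "\<eta> \<in> U" "U \<inter> ?C = {}"
    using \<eta> unfolding in_closure_of locally_convex_topspace[OF lc] by blast
  let ?U = "{f \<in> D. (- 1) *\<^sub>R f + \<eta> \<in> U}"
  have "openin \<tau> ?U" by (rule locally_convex_affine_preimage[OF lc \<eta>(1) U(1)])
  moreover have "0 \<in> ?U" using U(2) zero_in_dual by simp
  ultimately obtain N V where V: "openin \<tau> V" "0 \<in> V" "V \<subseteq> N" "N \<subseteq> ?U" "convex N"
    using lc unfolding locally_convex_topology_on_dual_def by meson
  \<comment> \<open>The neighbourhood of the hull, moved to the origin: convex, absorbing in the dual, and without \<open>\<eta> - a\<close>.\<close>
  define G where "G = {c - a + v | c v. c \<in> ?C \<and> v \<in> N}"
  have G_eq: "G = (\<lambda>x. x - a) ` (\<Union>c\<in>?C. \<Union>v\<in>N. {c + v})"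
    unfolding G_def diff_add_eq by blast
  have "convex G"
    unfolding G_eq by (intro convex_translation_subtract convex_sums V(5) convex_convex_hull)
  have zG: "\<eta> - a \<notin> G"
  proof
    assume "\<eta> - a \<in> G"
    then obtain c v where "c \<in> ?C" "v \<in> N" "\<eta> = c + v" by (auto simp: G_def algebra_simps)
    then have "c \<in> U" using V(4) by auto
    then show False using U(3) \<open>c \<in> ?C\<close> by blast
  qed
  obtain P where P: "linear P" "\<And>x. P x \<in> D" "\<And>x. x \<in> D \<Longrightarrow> P x = x"
    using linear_projection_onto_subspace[OF subspace_dual] by blast
  have NG: "v \<in> G" if "v \<in> N" for v using aC that by (force simp: G_def)
  have V_absorb: "\<exists>t>0. t *\<^sub>R f \<in> V" if "f \<in> D" for f
    using locally_convex_absorbing[OF lc V(1,2) that] by blast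
  obtain \<phi> :: "('a \<Rightarrow>\<^sub>L 'k) \<Rightarrow> real" where \<phi>: "linear \<phi>" "\<And>f. f \<in> P -` G \<Longrightarrow> \<phi> f \<le> 1" "1 \<le> \<phi> (\<eta> - a)"
  proof (rule hahn_banach_absorbing_convex)
    show "convex (P -` G)" by (rule convex_linear_vimage[OF P(1) \<open>convex G\<close>])
    show "0 \<in> P -` G" using NG V(2,3) by (simp add: linear_0[OF P(1)] subset_iff)
    show "\<exists>t>0. t *\<^sub>R f \<in> P -` G" for f
      using V_absorb[OF P(2)[of f]] V(3) NG by (auto simp: linear_scale[OF P(1)] subset_iff)
    show "\<eta> - a \<notin> P -` G"
      using zG P(3)[of "\<eta> - a"] diff_in_dual \<eta>(1) A(1) a by auto
  qed blast
  have GD: "G \<subseteq> D" using CD V(4) A(1) a by (auto simp: G_def intro!: add_in_dual diff_in_dual)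
  have le: "\<phi> c - \<phi> a + \<phi> v \<le> 1" if "c \<in> ?C" "v \<in> N" for c v
  proof -
    have "c - a + v \<in> G" using that by (auto simp: G_def)
    then have "\<phi> (c - a + v) \<le> 1" using GD P(3) by (intro \<phi>(2)) auto
    then show ?thesis by (simp add: linear_add[OF \<phi>(1)] linear_diff[OF \<phi>(1)])
  qed
  \<comment> \<open>The bound on \<open>G\<close> separates weakly; a multiple of \<open>\<eta> - a\<close> inside \<open>V\<close> provides the gap.\<close>
  obtain t where t: "0 < t" "t *\<^sub>R (\<eta> - a) \<in> V" using V_absorb[of "\<eta> - a"] diff_in_dual \<eta>(1) A(1) a by auto
  show thesis
  proof (rule that[OF \<phi>(1) V(1,2)])
    show "\<phi> v \<le> 1" if "v \<in> V" for v using le[OF aC] V(3) that by auto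
    show "0 < t * \<phi> (\<eta> - a)" using t(1) \<phi>(3) by simp
    show "\<phi> c + t * \<phi> (\<eta> - a) \<le> \<phi> \<eta>" if "c \<in> A" for c
    proof -
      have "\<phi> c - \<phi> a + \<phi> (t *\<^sub>R (\<eta> - a)) \<le> 1"
        using V(3) t(2) that by (intro le) (auto simp: hull_inc)
      then show ?thesis using \<phi>(3) by (simp add: linear_diff[OF \<phi>(1)] linear_scale[OF \<phi>(1)])
    qed
  qed
qed

lemma continuous_if_bounded_above_on_nhd:
  assumes lc: "locally_convex_topology_on_dual scl \<tau>" and \<phi>: "linear \<phi>"
    and V: "openin \<tau> V" "0 \<in> V" "\<And>v. v \<in> V \<Longrightarrow> \<phi> v \<le> (1::real)"
  shows "continuous_map \<tau> euclideanreal \<phi>"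
proof -
  note top = locally_convex_topspace[OF lc]
  have key: "\<exists>T. openin \<tau> T \<and> f \<in> T \<and> (\<forall>g\<in>T. g \<in> D \<and> r * (\<phi> g - \<phi> f) \<le> 1)" if f: "f \<in> D" for f r
  proof (intro exI[of _ "{g \<in> D. r *\<^sub>R g + (- r) *\<^sub>R f \<in> V}"] conjI ballI)
    show "openin \<tau> {g \<in> D. r *\<^sub>R g + (- r) *\<^sub>R f \<in> V}"
      by (rule locally_convex_affine_preimage[OF lc scaleR_in_dual[OF f] V(1)])
    fix g assume "g \<in> {g \<in> D. r *\<^sub>R g + (- r) *\<^sub>R f \<in> V}"
    then show "r * (\<phi> g - \<phi> f) \<le> 1"
      using V(3)[of "r *\<^sub>R g + (- r) *\<^sub>R f"]
      by (simp add: linear_add[OF \<phi>] linear_diff[OF \<phi>] linear_scale[OF \<phi>] algebra_simps)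
  qed (use f V(2) in auto)
  show ?thesis unfolding continuous_map_upper_lower_semicontinuous_lt
  proof (intro conjI allI)
    fix b
    have "\<exists>T. openin \<tau> T \<and> f \<in> T \<and> T \<subseteq> {x \<in> topspace \<tau>. b < \<phi> x}" if "f \<in> {x \<in> topspace \<tau>. b < \<phi> x}" for f
    proof -
      have f: "f \<in> D" "b < \<phi> f" using that top by auto
      obtain T where T: "openin \<tau> T" "f \<in> T" "\<And>g. g \<in> T \<Longrightarrow> g \<in> D" "\<And>g. g \<in> T \<Longrightarrow> (- 2 / (\<phi> f - b)) * (\<phi> g - \<phi> f) \<le> 1"
        using key[OF f(1), of "- 2 / (\<phi> f - b)"] by blast
      have "b < \<phi> g" if "g \<in> T" for g using T(4)[OF that] f(2) by (simp add: field_simps)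
      then show ?thesis using T top by blast
    qed
    then show "openin \<tau> {x \<in> topspace \<tau>. b < \<phi> x}" by (subst openin_subopen) blast
    have "\<exists>T. openin \<tau> T \<and> f \<in> T \<and> T \<subseteq> {x \<in> topspace \<tau>. \<phi> x < b}" if "f \<in> {x \<in> topspace \<tau>. \<phi> x < b}" for f
    proof -
      have f: "f \<in> D" "\<phi> f < b" using that top by auto
      obtain T where T: "openin \<tau> T" "f \<in> T" "\<And>g. g \<in> T \<Longrightarrow> g \<in> D" "\<And>g. g \<in> T \<Longrightarrow> (2 / (b - \<phi> f)) * (\<phi> g - \<phi> f) \<le> 1"
        using key[OF f(1), of "2 / (b - \<phi> f)"] by blast
      have "\<phi> g < b" if "g \<in> T" for g using T(4)[OF that] f(2) by (simp add: field_simps)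
      then show ?thesis using T top by blast
    qed
    then show "openin \<tau> {x \<in> topspace \<tau>. \<phi> x < b}" by (subst openin_subopen) blast
  qed
qed

lemma continuous_extend:
  assumes lc: "locally_convex_topology_on_dual scl \<tau>" and \<phi>: "continuous_map \<tau> euclideanreal \<phi>"
  shows "continuous_map \<tau> euclidean (extend dual_scale \<phi>)"
proof -
  have of_real: "continuous_map euclideanreal euclidean (of_real :: real \<Rightarrow> 'k)"
    by (auto intro!: continuous_intros)
  have "continuous_map \<tau> euclideanreal (\<lambda>f. \<phi> (dual_scale J f))"
    using continuous_map_compose[OF locally_convex_affine[OF lc zero_in_dual, of J] \<phi>] by (simp add: comp_def)
  then have 1: "continuous_map \<tau> euclidean (\<lambda>f. of_real (\<phi> (dual_scale J f)) :: 'k)"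
    using continuous_map_compose[OF _ of_real] by (force simp: comp_def)
  have 2: "continuous_map \<tau> euclidean (\<lambda>f. of_real (\<phi> f) :: 'k)"
    using continuous_map_compose[OF \<phi> of_real] by (simp add: comp_def)
  have times: "continuous_map euclidean euclidean (\<lambda>z. J * z)"
    by (auto intro!: continuous_intros)
  have 3: "continuous_map \<tau> euclidean (\<lambda>f. J * of_real (\<phi> (dual_scale J f)))"
    using continuous_map_compose[OF 1 times] by (simp add: comp_def)
  show ?thesis unfolding extend_def by (rule continuous_map_diff[OF 2 3])
qed

lemma dual_linear_extend: "linear \<phi> \<Longrightarrow> dual_linear (extend dual_scale \<phi>)"
  unfolding dual_linear_def
  by (simp add: extend_add[OF vector_space_dual_scale dual_scale_of_real] extend_scale[OF vector_space_dual_scale dual_scale_of_real])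

lemma re_extend_dual:
  fixes f :: "'a \<Rightarrow>\<^sub>L 'k"
  shows "linear \<phi> \<Longrightarrow> re (extend dual_scale \<phi> f) = \<phi> f"
  by (rule re_extend[OF vector_space_dual_scale dual_scale_of_real])

lemma dual_linear_canonical_embedding: "dual_linear (canonical_embedding scl x)"
  by (simp add: dual_linear_def canonical_embedding_def add_in_dual dual_scale_in_dual blinfun.add_left)

lemma canonical_embedding_apply [simp]: "f \<in> D \<Longrightarrow> canonical_embedding scl x f = f x"
  by (simp add: canonical_embedding_def)

lemma locally_convex_weak_star: "locally_convex_topology_on_dual scl (weak_star_dual scl)"
  unfolding weak_star_dual_def sigma_dual_def
  by (rule locally_convex_initial_topology) (auto simp: dual_linear_canonical_embedding)

section \<open>Weak* closed convex hulls and support functions\<close>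

text \<open>
  Induction on \<open>F\<close>: a new point \<open>a\<close> either imposes no further condition on the annihilator, or there
  is an \<open>h\<close> in the annihilator of \<open>F\<close> that does not vanish at \<open>a\<close>, and subtracting from \<open>\<phi>\<close> the multiple
  of the evaluation at \<open>a\<close> with the same value at \<open>h\<close> reduces to \<open>F\<close>.
\<close>
lemma functional_vanishing_on_annihilator:
  assumes "finite F" "linear \<phi>" "\<And>f. f \<in> D \<Longrightarrow> (\<And>x. x \<in> F \<Longrightarrow> re (f x) = 0) \<Longrightarrow> \<phi> f = (0::real)"
  shows "\<exists>x. \<forall>f\<in>D. \<phi> f = re (f x)"
  using assms
proof (induction F arbitrary: \<phi> rule: finite_induct)
  case empty
  then show ?case by (intro exI[of _ 0]) (auto simp: re_zero)
next
  case (insert a F)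
  show ?case
  proof (cases "\<exists>h\<in>D. (\<forall>x\<in>F. re (h x) = 0) \<and> re (h a) \<noteq> 0")
    case False
    then show ?thesis using insert.IH[OF insert.prems(1)] insert.prems(2) by (metis insert_iff)
  next
    case True
    then obtain h where h: "h \<in> D" "\<And>x. x \<in> F \<Longrightarrow> re (h x) = 0" "re (h a) \<noteq> 0" by blast
    define c where "c = \<phi> h / re (h a)"
    have lin: "linear (\<lambda>f :: 'a \<Rightarrow>\<^sub>L 'k. c * re (f a))"
      by (simp add: linear_iff blinfun.add_left blinfun.scaleR_left re_add linear_scale[OF linear_re] algebra_simps)
    have "\<exists>x. \<forall>f\<in>D. \<phi> f - c * re (f a) = re (f x)"
    proof (rule insert.IH)
      show "linear (\<lambda>f. \<phi> f - c * re (f a))"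
        by (rule linear_compose_sub[OF insert.prems(1) lin])
      fix f assume f: "f \<in> D" "\<And>x. x \<in> F \<Longrightarrow> re (f x) = 0"
      define s where "s = re (f a) / re (h a)"
      have "\<phi> (f - s *\<^sub>R h) = 0"
      proof (rule insert.prems(2))
        show "f - s *\<^sub>R h \<in> D" by (intro diff_in_dual scaleR_in_dual f h)
        show "re ((f - s *\<^sub>R h) x) = 0" if "x \<in> insert a F" for x
          using that f h by (auto simp: blinfun.diff_left blinfun.scaleR_left re_diff linear_scale[OF linear_re] s_def)
      qed
      then show "\<phi> f - c * re (f a) = 0"
        by (simp add: linear_diff[OF insert.prems(1)] linear_scale[OF insert.prems(1)] c_def s_def)
    qed
    then obtain x where x: "\<And>f. f \<in> D \<Longrightarrow> \<phi> f - c * re (f a) = re (f x)" by blast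
    have "\<phi> f = re (f (x + c *\<^sub>R a))" if "f \<in> D" for f
      using x[OF that] by (simp add: blinfun.add_right blinfun.scaleR_right re_add linear_scale[OF linear_re])
    then show ?thesis by blast
  qed
qed

text \<open>
  \<open>V\<close> contains the common kernel of finitely many evaluations, a linear subspace, and a linear functional
  bounded above on a subspace vanishes there.
\<close>
lemma weak_star_functional_is_evaluation:
  assumes \<phi>: "linear \<phi>" and V: "openin (weak_star_dual scl) V" "0 \<in> V" "\<And>v. v \<in> V \<Longrightarrow> \<phi> v \<le> (1::real)"
  obtains x where "\<And>f. f \<in> D \<Longrightarrow> \<phi> f = re (f x)"
proof -
  obtain F' e where F': "finite F'" "F' \<subseteq> range (canonical_embedding scl)" "0 < e"
    "{f \<in> D. \<forall>\<phi>\<in>F'. norm (\<phi> f) < e} \<subseteq> V"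
    using initial_topology_nhds_zero[OF V(1,2)[unfolded weak_star_dual_def sigma_dual_def]]
      dual_linear_0[OF dual_linear_canonical_embedding] by blast
  obtain F where F: "finite F" "F' = canonical_embedding scl ` F"
    using finite_subset_image[OF F'(1,2)] by blast
  have "\<exists>x. \<forall>f\<in>D. \<phi> f = re (f x)"
  proof (rule functional_vanishing_on_annihilator[OF _ \<phi>])
    \<comment> \<open>Only real parts are controlled; those at \<open>scl J x\<close> take care of the imaginary parts at \<open>x\<close>.\<close>
    show "finite (F \<union> scl J ` F)" using F(1) by simp
    fix f assume f: "f \<in> D" and zero: "\<And>x. x \<in> F \<union> scl J ` F \<Longrightarrow> re (f x) = 0"
    have "f x = 0" if "x \<in> F" for x
    proof -
      have "re (f x) = 0" "re (J * f x) = 0" using zero[of x] zero[of "scl J x"] that f by (auto simp: dual_iff)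
      then show ?thesis using decomp[of "f x"] by simp
    qed
    then have "r *\<^sub>R f \<in> V" for r
      using F'(3,4) F(2) scaleR_in_dual[OF f] by (auto simp: subset_iff blinfun.scaleR_left)
    then have le: "r * \<phi> f \<le> 1" for r using V(3)[of "r *\<^sub>R f"] by (simp add: linear_scale[OF \<phi>])
    show "\<phi> f = 0"
    proof (rule ccontr)
      assume "\<phi> f \<noteq> 0"
      then show False using le[of "2 / \<phi> f"] by simp
    qed
  qed
  then show thesis using that by blast
qed

abbreviation weak_star_hull :: "('a \<Rightarrow>\<^sub>L 'k) set \<Rightarrow> ('a \<Rightarrow>\<^sub>L 'k) set" where
  "weak_star_hull S \<equiv> weak_star_dual scl closure_of (convex hull S)"

lemma closedin_dual_halfspace:
  assumes top: "topspace \<tau> = D" and \<Phi>: "continuous_map \<tau> euclidean \<Phi>"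
  shows "closedin \<tau> {f \<in> D. re (\<Phi> f) \<le> c}"
proof -
  have "continuous_map \<tau> euclideanreal (\<lambda>f. re (\<Phi> f))"
    using continuous_map_compose[OF \<Phi>, of euclidean re] continuous_re by (simp add: comp_def)
  then show ?thesis
    using closedin_continuous_map_preimage[of \<tau> euclideanreal _ "{..c}"] top by auto
qed

lemma closure_of_convex_hull_subset_halfspace:
  assumes top: "topspace \<tau> = D" and \<Phi>: "dual_linear \<Phi>" "continuous_map \<tau> euclidean \<Phi>"
    and S: "S \<subseteq> D" "\<And>f. f \<in> S \<Longrightarrow> re (\<Phi> f) \<le> c"
  shows "\<tau> closure_of (convex hull S) \<subseteq> {f \<in> D. re (\<Phi> f) \<le> c}"
  using S by (intro closure_of_minimal closedin_dual_halfspace top \<Phi>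
      hull_minimal convex_halfspace_dual_linear) auto

text \<open>
  The bipolar theorem. Quantifying over all upper bounds \<open>c\<close> instead of taking a supremum makes it valid
  for every \<open>S\<close>, the empty set included, for which both sides are false.
\<close>
lemma weak_star_hull_iff:
  assumes S: "S \<subseteq> D" and g: "g \<in> D"
  shows "g \<in> weak_star_hull S \<longleftrightarrow> (\<forall>x c. (\<forall>f\<in>S. re (f x) \<le> c) \<longrightarrow> re (g x) \<le> c)"
proof (intro iffI allI impI)
  fix x c assume gS: "g \<in> weak_star_hull S" and c: "\<forall>f\<in>S. re (f x) \<le> c"
  have "weak_star_hull S \<subseteq> {f \<in> D. re (canonical_embedding scl x f) \<le> c}"
    using S c
    by (intro closure_of_convex_hull_subset_halfspace dual_linear_canonical_embedding)
       (auto simp: weak_star_dual_def sigma_dual_def intro!: continuous_map_initial_topology)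
  then show "re (g x) \<le> c" using gS g by auto
next
  assume polar: "\<forall>x c. (\<forall>f\<in>S. re (f x) \<le> c) \<longrightarrow> re (g x) \<le> c"
  show "g \<in> weak_star_hull S"
  proof (rule ccontr)
    assume out: "g \<notin> weak_star_hull S"
    have "S \<noteq> {}"
    proof
      assume "S = {}"
      then have "re (g 0) \<le> - 1" using polar by blast
      then show False by (simp add: re_zero)
    qed
    then obtain \<phi> V e where \<phi>: "linear \<phi>" "openin (weak_star_dual scl) V" "0 \<in> V" "\<And>v. v \<in> V \<Longrightarrow> \<phi> v \<le> (1::real)"
      "0 < e" "\<And>a. a \<in> S \<Longrightarrow> \<phi> a + e \<le> \<phi> g"
      using separation_from_closed_convex_hull[OF locally_convex_weak_star S _ g out] by metis
    obtain x where x: "\<And>f. f \<in> D \<Longrightarrow> \<phi> f = re (f x)"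
      using weak_star_functional_is_evaluation[OF \<phi>(1-4)] by blast
    have "re (g x) \<le> re (g x) - e"
    proof -
      have "re (f x) \<le> re (g x) - e" if "f \<in> S" for f
        using \<phi>(6)[OF that] x[of f] x[OF g] that S by auto
      then show ?thesis using polar by blast
    qed
    then show False using \<phi>(5) by simp
  qed
qed

end

context scalar_banach begin

definition support_function :: "('a \<Rightarrow>\<^sub>L 'k) set \<Rightarrow> 'a \<Rightarrow> real" where
  "support_function S x = (SUP f\<in>S. re (blinfun_apply f x))"

lemma re_le_norm_blinfun: "re (blinfun_apply f x) \<le> norm f * norm x"
  using abs_re_le[of "blinfun_apply f x"] norm_blinfun[of f x] by linarith

lemma dual_eqI:
  assumes "f \<in> D" "g \<in> D" "\<And>x. re (f x) = re (g x)"
  shows "f = g"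
proof (rule blinfun_eqI)
  fix x
  have "re (J * f x) = re (J * g x)" using assms(3)[of "scl J x"] assms(1,2) by (simp add: dual_iff)
  then show "f x = g x" using decomp[of "f x"] decomp[of "g x"] assms(3)[of x] by simp
qed

lemma linear_re_blinfun: "linear (\<lambda>x. re (blinfun_apply f x))"
  by (simp add: linear_iff blinfun.add_right blinfun.scaleR_right re_add linear_scale[OF linear_re])

text \<open>
  The bound passes from the real part to the modulus by rotating \<open>x\<close> with a scalar of modulus \<open>1\<close> that
  makes the value at \<open>x\<close> nonnegative.
\<close>
lemma dual_of_bounded_real_functional:
  assumes u: "linear u" and le: "\<And>x. u x \<le> C * norm x"
  obtains g where "g \<in> D" "\<And>x. re (g x) = u x" "\<And>x. norm (g x) \<le> C * norm x"
proof -
  let ?G = "extend scl u"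
  note ext = extend_add[OF vector_space_axioms scl_of_real u] extend_scale[OF vector_space_axioms scl_of_real u]
    re_extend[OF vector_space_axioms scl_of_real u]
  have bound: "norm (?G x) \<le> C * norm x" for x
  proof (cases "?G x = 0")
    case True
    then show ?thesis using le[of x] ext(3)[of x] by (simp add: re_zero)
  next
    case False
    define c where "c = of_real (norm (?G x)) / ?G x"
    have "norm (?G x) = re (c * ?G x)" using False by (simp add: c_def re_of_real)
    also have "\<dots> = u (scl c x)" using ext by metis
    also have "\<dots> \<le> C * norm (scl c x)" by (rule le)
    also have "\<dots> = C * norm x" using False by (simp add: norm_scl c_def norm_divide)
    finally show ?thesis .
  qed
  have "bounded_linear ?G"
  proof (rule bounded_linear_intro[of _ C])
    show "?G (r *\<^sub>R x) = r *\<^sub>R ?G x" for r x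
      using ext(2)[of "of_real r" x] by (simp add: scl_of_real scaleR_conv_of_real)
    show "norm (?G x) \<le> norm x * C" for x using bound[of x] by (simp add: mult.commute)
  qed (rule ext(1))
  then have app: "blinfun_apply (Blinfun ?G) = ?G" by (rule bounded_linear_Blinfun_apply)
  show thesis
    by (rule that[of "Blinfun ?G"]) (use ext bound in \<open>auto simp: app dual_iff\<close>)
qed

lemma
  fixes S :: "('a \<Rightarrow>\<^sub>L 'k) set"
  assumes "bounded S" "S \<noteq> {}"
  shows re_le_support_function: "f \<in> S \<Longrightarrow> re (f x) \<le> support_function S x"
    and support_function_le: "(\<And>f. f \<in> S \<Longrightarrow> re (f x) \<le> c) \<Longrightarrow> support_function S x \<le> c"
    and sublinear_support_function: "sublinear (support_function S)"
    and support_function_le_norm: "\<exists>C. \<forall>x. support_function S x \<le> C * norm x"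
proof -
  obtain C where C: "\<And>f. f \<in> S \<Longrightarrow> norm f \<le> C" using assms(1) by (auto simp: bounded_iff)
  have bound: "re (f x) \<le> C * norm x" if "f \<in> S" for f x
    using re_le_norm_blinfun[of f x] mult_right_mono[OF C[OF that], of "norm x"] by simp
  then have bdd: "bdd_above ((\<lambda>f. re (blinfun_apply f x)) ` S)" for x by (auto simp: bdd_above_def)
  show le: "re (f x) \<le> support_function S x" if "f \<in> S" for f x
    unfolding support_function_def by (rule cSUP_upper[OF that bdd])
  show least: "support_function S x \<le> c" if "\<And>f. f \<in> S \<Longrightarrow> re (f x) \<le> c" for x c
    unfolding support_function_def by (rule cSUP_least[OF assms(2) that])
  show "\<exists>C. \<forall>x. support_function S x \<le> C * norm x" using least bound by blast
  show "sublinear (support_function S)"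
  proof (rule sublinearI)
    show "support_function S (x + y) \<le> support_function S x + support_function S y" for x y
      by (rule least) (auto simp: blinfun.add_right re_add intro!: add_mono le)
    show "support_function S (t *\<^sub>R x) \<le> t * support_function S x" if "0 < t" for t x
      using that by (intro least) (auto simp: blinfun.scaleR_right linear_scale[OF linear_re] intro!: le)
  qed
qed

lemma weak_star_hull_subset_dual: "weak_star_hull S \<subseteq> D"
  using closure_of_subset_topspace[of "weak_star_dual scl"] locally_convex_topspace[OF locally_convex_weak_star] by blast

lemma weak_star_hull_iff_support_function:
  assumes "S \<subseteq> D" "bounded S" "S \<noteq> {}" "g \<in> D"
  shows "g \<in> weak_star_hull S \<longleftrightarrow> (\<forall>x. re (g x) \<le> support_function S x)"
  unfolding weak_star_hull_iff[OF assms(1,4)]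
  using re_le_support_function[OF assms(2,3)] support_function_le[OF assms(2,3)] by (meson order_trans)

text \<open>
  The support function of \<open>S \<union> T\<close> is the maximum of those of \<open>S\<close> and \<open>T\<close>. A linear functional below
  this maximum is below a convex combination of the two by the minimax lemma, hence a sum of two functionals below the
  two terms by \<open>linear_le_sum_decompose\<close>; dividing by the weights gives members of the two hulls.
  Boundedness guarantees that the summands are again elements of the dual.
\<close>
lemma weak_star_hull_Un:
  assumes S: "S \<subseteq> D" "bounded S" and T: "T \<subseteq> D" "bounded T"
  shows "weak_star_hull (S \<union> T) \<subseteq> convex hull (weak_star_hull S \<union> weak_star_hull T)"
proof (cases "S = {} \<or> T = {}")
  case True
  then show ?thesis using hull_subset[of "weak_star_hull S \<union> weak_star_hull T" convex] by auto
next
  case False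
  then have ne: "S \<noteq> {}" "T \<noteq> {}" by auto
  note supS = re_le_support_function[OF S(2) ne(1)] support_function_le[OF S(2) ne(1)] sublinear_support_function[OF S(2) ne(1)]
  note supT = re_le_support_function[OF T(2) ne(2)] support_function_le[OF T(2) ne(2)] sublinear_support_function[OF T(2) ne(2)]
  show ?thesis
  proof
    fix g assume g: "g \<in> weak_star_hull (S \<union> T)"
    then have gD: "g \<in> D" using weak_star_hull_subset_dual by blast
    define u where "u = (\<lambda>x. re (g x))"
    have u: "linear u" unfolding u_def by (rule linear_re_blinfun)
    have "u x \<le> max (support_function S x) (support_function T x)" for x
    proof -
      have "u x \<le> support_function (S \<union> T) x"
        using g gD S T ne by (subst (asm) weak_star_hull_iff_support_function) (auto simp: u_def)
      also have "\<dots> \<le> max (support_function S x) (support_function T x)"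
        using supS(1) supT(1) S T ne by (intro support_function_le) (auto simp: le_max_iff_disj)
      finally show ?thesis .
    qed
    then have "0 \<le> max (support_function S x - u x) (support_function T x - u x)" for x
      by (simp add: max_def split: if_splits) (metis (full_types))
    then obtain t where t: "0 \<le> t" "t \<le> 1" "\<And>x. 0 \<le> t * (support_function S x - u x) + (1 - t) * (support_function T x - u x)"
      using sublinear_max_nonneg_imp_convex_combination[OF sublinear_minus_linear[OF supS(3) u]
          sublinear_minus_linear[OF supT(3) u]] by blast
    then have le: "u x \<le> t * support_function S x + (1 - t) * support_function T x" for x
      using t(3)[of x] by (simp add: algebra_simps)
    \<comment> \<open>A weight that vanishes cannot be divided by, but then \<open>g\<close> itself lies in one of the hulls.\<close>
    consider "t = 0" | "t = 1" | "0 < t" "t < 1" using t by linarith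
    then show "g \<in> convex hull (weak_star_hull S \<union> weak_star_hull T)"
    proof cases
      case 1
      then have "g \<in> weak_star_hull T"
        using le gD T ne weak_star_hull_iff_support_function by (simp add: u_def)
      then show ?thesis by (simp add: hull_inc)
    next
      case 2
      then have "g \<in> weak_star_hull S"
        using le gD S ne weak_star_hull_iff_support_function by (simp add: u_def)
      then show ?thesis by (simp add: hull_inc)
    next
      case 3
      have pieces: "\<exists>h\<in>weak_star_hull R. \<forall>x. s * re (h x) = v x"
        if R: "R \<subseteq> D" "bounded R" "R \<noteq> {}" and s: "0 < s" and v: "linear v" "\<And>x. v x \<le> s * support_function R x" for R s v
      proof -
        have le: "v x / s \<le> support_function R x" for x using v(2)[of x] s by (simp add: field_simps)
        obtain C where "\<And>x. support_function R x \<le> C * norm x" using support_function_le_norm[OF R(2,3)] by blast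
        then have "v x / s \<le> C * norm x" for x using le[of x] order_trans by blast
        moreover have "linear (\<lambda>x. v x / s)"
          using v(1) by (simp add: linear_iff add_divide_distrib)
        ultimately obtain h where h: "h \<in> D" "\<And>x. re (h x) = v x / s"
          using dual_of_bounded_real_functional[of "\<lambda>x. v x / s" C] by blast
        have "h \<in> weak_star_hull R" using weak_star_hull_iff_support_function[OF R h(1)] le h(2) by simp
        then show ?thesis using h(2) s by (intro bexI[of _ h]) auto
      qed
      obtain u1 u2 where u12: "linear u1" "linear u2" "\<And>x. u1 x \<le> t * support_function S x"
        "\<And>x. u2 x \<le> (1 - t) * support_function T x" "\<And>x. u x = u1 x + u2 x"
        using linear_le_sum_decompose[OF sublinear_cmult[OF supS(3), of t] sublinear_cmult[OF supT(3), of "1 - t"] u le] t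
        by auto
      obtain g1 where g1: "g1 \<in> weak_star_hull S" "\<And>x. t * re (g1 x) = u1 x"
        using pieces[OF S ne(1) 3(1) u12(1,3)] by blast
      obtain g2 where g2: "g2 \<in> weak_star_hull T" "\<And>x. (1 - t) * re (g2 x) = u2 x"
        using pieces[OF T ne(2) _ u12(2,4)] 3 by auto
      have "g = t *\<^sub>R g1 + (1 - t) *\<^sub>R g2"
      proof (rule dual_eqI[OF gD])
        show "t *\<^sub>R g1 + (1 - t) *\<^sub>R g2 \<in> D"
          using g1(1) g2(1) weak_star_hull_subset_dual by (intro add_in_dual scaleR_in_dual) auto
        show "re (g x) = re ((t *\<^sub>R g1 + (1 - t) *\<^sub>R g2) x)" for x
          using u12(5)[of x] g1(2)[of x] g2(2)[of x]
          by (simp add: u_def blinfun.add_left blinfun.scaleR_left re_add linear_scale[OF linear_re])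
      qed
      moreover have "t *\<^sub>R g1 + (1 - t) *\<^sub>R g2 \<in> convex hull (weak_star_hull S \<union> weak_star_hull T)"
        using g1(1) g2(1) t by (intro convexD[OF convex_convex_hull]) (auto simp: hull_inc)
      ultimately show ?thesis by simp
    qed
  qed
qed

lemma weak_star_hull_mono: "S \<subseteq> T \<Longrightarrow> weak_star_hull S \<subseteq> weak_star_hull T"
  by (intro closure_of_mono hull_mono)

lemma weak_star_hull_finite_UN:
  assumes "finite I" "\<And>i. i \<in> I \<Longrightarrow> S i \<subseteq> D" "\<And>i. i \<in> I \<Longrightarrow> bounded (S i)"
  shows "weak_star_hull (\<Union>i\<in>I. S i) \<subseteq> convex hull (\<Union>i\<in>I. weak_star_hull (S i))"
  using assms
proof (induction I rule: finite_induct)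
  case empty
  then show ?case by simp
next
  case (insert i I)
  let ?H = "convex hull (\<Union>j\<in>insert i I. weak_star_hull (S j))"
  have "weak_star_hull (\<Union>j\<in>I. S j) \<subseteq> convex hull (\<Union>j\<in>I. weak_star_hull (S j))"
    using insert by blast
  also have "\<dots> \<subseteq> ?H" by (intro hull_mono) auto
  finally have "weak_star_hull (S i) \<union> weak_star_hull (\<Union>j\<in>I. S j) \<subseteq> ?H"
    by (auto simp: hull_inc)
  then have "convex hull (weak_star_hull (S i) \<union> weak_star_hull (\<Union>j\<in>I. S j)) \<subseteq> ?H"
    by (rule hull_minimal) (rule convex_convex_hull)
  moreover have "weak_star_hull (S i \<union> (\<Union>j\<in>I. S j))
      \<subseteq> convex hull (weak_star_hull (S i) \<union> weak_star_hull (\<Union>j\<in>I. S j))"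
    using insert by (intro weak_star_hull_Un) (auto intro!: bounded_UN)
  ultimately show ?case by auto
qed

text \<open>
  If no such \<open>x\<close> existed, homogeneity would give \<open>Re \<eta> x \<le> h x + d * norm x\<close> for all \<open>x\<close>, where \<open>h\<close> is
  the support function of \<open>S\<close>. Splitting \<open>\<eta>\<close> accordingly yields a point of the weak* closed hull at
  distance at most \<open>d\<close> from \<open>\<eta>\<close>.
\<close>
lemma weak_star_separation_from_ball:
  assumes S: "S \<subseteq> D" "bounded S" and \<eta>: "\<eta> \<in> D" and d: "0 < d"
    and far: "\<And>g. g \<in> weak_star_hull S \<Longrightarrow> d < norm (g - \<eta>)"
  shows "\<exists>x. norm x \<le> 1 \<and> (\<forall>f\<in>S. re (f x) \<le> re (\<eta> x) - d)"
proof (rule ccontr)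
  assume "\<not> ?thesis"
  then have not: "\<exists>f\<in>S. re (\<eta> x) - d < re (f x)" if "norm x \<le> 1" for x
    using that by (meson not_le)
  have ne: "S \<noteq> {}" using not[of 0] by auto
  have le: "re (\<eta> x) \<le> support_function S x + d * norm x" for x
  proof (cases "x = 0")
    case True
    then show ?thesis using sublinear_0[OF sublinear_support_function[OF S(2) ne]] by (simp add: re_zero)
  next
    case False
    have "norm (x /\<^sub>R norm x) \<le> 1" using False by simp
    then obtain f where f: "f \<in> S" "re (\<eta> (x /\<^sub>R norm x)) - d < re (f (x /\<^sub>R norm x))"
      using not by blast
    have "norm x * (re (\<eta> (x /\<^sub>R norm x)) - d) < norm x * re (f (x /\<^sub>R norm x))"
      using f(2) False by (intro mult_strict_left_mono) auto
    then have "re (\<eta> x) - d * norm x < re (f x)"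
      using False by (simp add: blinfun.scaleR_right linear_scale[OF linear_re] right_diff_distrib
          mult.assoc[symmetric] mult.commute[of d])
    then show ?thesis using re_le_support_function[OF S(2) ne f(1), of x] by simp
  qed
  have "sublinear (\<lambda>x::'a. d * norm x)"
    using d by (simp add: sublinear_def norm_triangle_ineq distrib_left[symmetric])
  then obtain u1 u2 where u: "linear u1" "linear u2" "\<And>x. u1 x \<le> support_function S x" "\<And>x. u2 x \<le> d * norm x"
    "\<And>x. re (\<eta> x) = u1 x + u2 x"
    using linear_le_sum_decompose[OF sublinear_support_function[OF S(2) ne] _ linear_re_blinfun[of \<eta>] le] by blast
  obtain h where h: "h \<in> D" "\<And>x. re (h x) = u2 x" "\<And>x. norm (h x) \<le> d * norm x"
    using dual_of_bounded_real_functional[OF u(2,4)] by blast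
  have "re ((\<eta> - h) x) = u1 x" for x using u(5)[of x] h(2)[of x] by (simp add: blinfun.diff_left re_diff)
  then have "\<eta> - h \<in> weak_star_hull S"
    using weak_star_hull_iff_support_function[OF S ne] u(3) diff_in_dual[OF \<eta> h(1)] by simp
  then have "d < norm h" using far[of "\<eta> - h"] by simp
  moreover have "norm h \<le> d" using h(3) d by (intro norm_blinfun_bound) auto
  ultimately show False by simp
qed

section \<open>The (I)-envelope and the space of weak* sequential limits\<close>

lemma bidual_iff:
  "\<phi> \<in> bidual_space scl \<longleftrightarrow>
     \<phi> \<in> extensional D \<and> dual_linear \<phi> \<and> (\<exists>C. \<forall>f\<in>D. norm (\<phi> f) \<le> C * norm f)"
  by (auto simp: bidual_space_def dual_linear_def)

lemma canonical_embedding_in_bidual: "canonical_embedding scl x \<in> bidual_space scl"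
proof -
  have "\<forall>f\<in>D. norm (canonical_embedding scl x f) \<le> norm x * norm f"
    using norm_blinfun by (auto simp: mult.commute)
  then show ?thesis
    unfolding bidual_iff using dual_linear_canonical_embedding
    by (auto simp: canonical_embedding_def)
qed

lemma B1_iff:
  "\<phi> \<in> B1 scl \<longleftrightarrow> \<phi> \<in> bidual_space scl \<and> (\<exists>x. \<forall>f\<in>D. (\<lambda>n. blinfun_apply f (x n)) \<longlonglongrightarrow> \<phi> f)"
  by (auto simp: B1_def weak_star_bidual_def limitin_initial_topology canonical_embedding_in_bidual)

lemma I_env_subset_dual:
  assumes "A \<subseteq> D" shows "I_env scl A \<subseteq> D"
proof -
  have "I_env scl A \<subseteq> closure (convex hull (\<Union>n::nat. weak_star_hull A))"
    unfolding I_env_def by (rule Inter_lower) (auto intro!: exI[of _ "\<lambda>_. A"])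
  also have "\<dots> \<subseteq> D"
    using weak_star_hull_subset_dual by (intro closure_minimal hull_minimal closed_dual convex_dual) auto
  finally show ?thesis .
qed

lemma closed_halfspace_bounded_functional:
  assumes \<Phi>: "dual_linear \<Phi>" and C: "\<And>f. f \<in> D \<Longrightarrow> norm (\<Phi> f) \<le> C * norm f"
  shows "closed {f \<in> D. re (\<Phi> f) \<le> c}"
proof -
  have "\<bar>C\<bar>-lipschitz_on D \<Phi>"
  proof (rule lipschitz_onI)
    fix f g assume fg: "f \<in> D" "g \<in> D"
    have "dist (\<Phi> f) (\<Phi> g) = norm (\<Phi> (f - g))" using fg by (simp add: dist_norm dual_linear_diff[OF \<Phi>])
    also have "\<dots> \<le> C * norm (f - g)" by (rule C[OF diff_in_dual[OF fg]])
    also have "\<dots> \<le> \<bar>C\<bar> * dist f g" by (simp add: dist_norm mult_right_mono)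
    finally show "dist (\<Phi> f) (\<Phi> g) \<le> \<bar>C\<bar> * dist f g" .
  qed simp
  then have "continuous_on D \<Phi>" by (rule lipschitz_on_continuous_on)
  then have "continuous_on D (\<lambda>f. re (\<Phi> f))"
    by (rule continuous_on_compose2[OF continuous_re]) auto
  then show ?thesis
    by (intro continuous_on_closed_Collect_le closed_dual continuous_on_const)
qed

lemma tendsto_re: "(f \<longlongrightarrow> l) F \<Longrightarrow> ((\<lambda>n. re (f n)) \<longlongrightarrow> re l) F"
  using continuous_re by (rule continuous_on_tendsto_compose) auto

text \<open>
  For \<open>d > c\<close> the members \<open>f\<close> of the half-space are sorted by the index from which on
  \<open>Re f x\<^sub>k \<le> d\<close> holds. For a fixed index these inequalities survive weak* closed convex hulls, and in
  the limit they give \<open>Re \<Phi> f \<le> d\<close>.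
\<close>
lemma I_env_halfspace_subset:
  assumes \<Phi>: "dual_linear \<Phi>" and C: "\<And>f. f \<in> D \<Longrightarrow> norm (\<Phi> f) \<le> C * norm f"
    and lim: "\<And>f. f \<in> D \<Longrightarrow> (\<lambda>n. blinfun_apply f (x n)) \<longlonglongrightarrow> \<Phi> f"
  shows "I_env scl {f \<in> D. re (\<Phi> f) \<le> c} \<subseteq> {f \<in> D. re (\<Phi> f) \<le> c}"
proof
  let ?H = "{f \<in> D. re (\<Phi> f) \<le> c}"
  fix \<eta> assume \<eta>: "\<eta> \<in> I_env scl ?H"
  have "re (\<Phi> \<eta>) \<le> d" if d: "c < d" for d
  proof -
    let ?K = "{f \<in> D. re (\<Phi> f) \<le> d}"
    define As where "As n = {f \<in> ?H. \<forall>k\<ge>n. re (f (x k)) \<le> d}" for n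
    have "\<exists>n. f \<in> As n" if f: "f \<in> ?H" for f
    proof -
      have "\<forall>\<^sub>F n in sequentially. re (f (x n)) < d"
        using f d by (intro order_tendstoD(2)[OF tendsto_re[OF lim]]) auto
      then obtain n where "\<And>k. n \<le> k \<Longrightarrow> re (f (x k)) < d" by (auto simp: eventually_sequentially)
      then have "f \<in> As n" using f by (auto simp: As_def less_imp_le)
      then show ?thesis by blast
    qed
    then have cover: "?H = (\<Union>n. As n)" by (auto simp: As_def)
    have "weak_star_hull (As n) \<subseteq> ?K" for n
    proof
      fix g assume g: "g \<in> weak_star_hull (As n)"
      then have gD: "g \<in> D" using weak_star_hull_subset_dual by blast
      have AsD: "As n \<subseteq> D" by (auto simp: As_def)
      have "re (g (x k)) \<le> d" if "n \<le> k" for k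
        using g[unfolded weak_star_hull_iff[OF AsD gD]] that by (auto simp: As_def)
      then have "re (\<Phi> g) \<le> d"
        by (intro tendsto_upperbound[OF tendsto_re[OF lim[OF gD]]]) (auto simp: eventually_sequentially)
      then show "g \<in> ?K" using gD by simp
    qed
    then have "closure (convex hull (\<Union>n. weak_star_hull (As n))) \<subseteq> ?K"
      by (intro closure_minimal hull_minimal convex_halfspace_dual_linear \<Phi>
          closed_halfspace_bounded_functional[OF \<Phi> C]) auto
    moreover have "\<eta> \<in> closure (convex hull (\<Union>n. weak_star_hull (As n)))"
      using \<eta> cover unfolding I_env_def by blast
    ultimately show ?thesis by auto
  qed
  then have "re (\<Phi> \<eta>) \<le> c" by (rule dense_ge)
  then show "\<eta> \<in> ?H" using \<eta> I_env_subset_dual[of ?H] by auto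
qed

text \<open>
  The core of the proof: a point outside the (I)-envelope of the kernel produces a sequence that
  converges weak* to \<open>\<Phi>\<close>. Norm boundedness of \<open>\<Phi>\<close> comes out along the way, since the sequence constructed is
  eventually bounded by \<open>1 / d\<close>.
\<close>
lemma kernel_I_env_imp_B1:
  assumes \<Phi>: "dual_linear \<Phi>" and \<eta>: "\<eta> \<in> D" "\<Phi> \<eta> = 1" "\<eta> \<notin> I_env scl {f \<in> D. \<Phi> f = 0}"
  shows "restrict \<Phi> D \<in> B1 scl"
proof -
  let ?M = "{f \<in> D. \<Phi> f = 0}"
  obtain As :: "nat \<Rightarrow> ('a \<Rightarrow>\<^sub>L 'k) set" where As: "?M = (\<Union>n. As n)"
    "\<eta> \<notin> closure (convex hull (\<Union>n. weak_star_hull (As n)))"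
    using \<eta>(3) unfolding I_env_def by blast
  let ?E = "convex hull (\<Union>n. weak_star_hull (As n))"
  obtain e where e: "0 < e" "\<And>g. g \<in> ?E \<Longrightarrow> e \<le> norm (g - \<eta>)"
    using As(2) unfolding closure_approachable dist_norm by force
  define d where "d = e / 2"
  have d: "0 < d" "\<And>g. g \<in> ?E \<Longrightarrow> d < norm (g - \<eta>)"
    using e by (auto simp: d_def) (smt (verit) field_sum_of_halves)
  have AsD: "As n \<subseteq> D" for n using As(1) by auto
  \<comment> \<open>An increasing sequence of bounded sets with union \<open>?M\<close>, whose weak* hulls remain inside \<open>?E\<close>.\<close>
  define S where "S n = (\<Union>k\<in>{..n}. As k \<inter> cball 0 (real n))" for n
  have "\<exists>x. norm x \<le> 1 \<and> (\<forall>f\<in>S n. re (f x) \<le> re (\<eta> x) - d)" for n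
  proof -
    have "weak_star_hull (S n) \<subseteq> convex hull (\<Union>k\<in>{..n}. weak_star_hull (As k \<inter> cball 0 (real n)))"
      unfolding S_def using AsD by (intro weak_star_hull_finite_UN) (auto simp: bounded_Int)
    also have "\<dots> \<subseteq> ?E"
      by (intro hull_mono UN_mono weak_star_hull_mono) auto
    finally have sub: "weak_star_hull (S n) \<subseteq> ?E" .
    have "S n \<subseteq> D" "bounded (S n)" using AsD by (auto simp: S_def intro!: bounded_UN bounded_Int)
    then show ?thesis
      by (rule weak_star_separation_from_ball) (use \<eta>(1) d sub in auto)
  qed
  then obtain x where x: "\<And>n. norm (x n) \<le> 1" "\<And>n f. f \<in> S n \<Longrightarrow> re (f (x n)) \<le> re (\<eta> (x n)) - d"
    by metis
  have ev: "\<forall>\<^sub>F n in sequentially. re (f (x n)) \<le> re (\<eta> (x n)) - d" if f: "f \<in> ?M" for f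
  proof -
    obtain k where k: "f \<in> As k" using f As(1) by blast
    obtain m :: nat where m: "norm f \<le> m" using real_arch_simple by blast
    have "f \<in> S n" if "max k m \<le> n" for n
      using k m that by (auto simp: S_def intro!: bexI[of _ k])
    then show ?thesis using x(2) unfolding eventually_sequentially by blast
  qed
  have zeroM: "0 \<in> ?M" using zero_in_dual dual_linear_0[OF \<Phi>] by simp
  have \<eta>_ev: "\<forall>\<^sub>F n in sequentially. d \<le> re (\<eta> (x n))"
    using ev[OF zeroM] by eventually_elim (simp add: re_zero)
  have scaleM: "dual_scale c f \<in> ?M" if "f \<in> ?M" for c f
    using that dual_scale_in_dual dual_linear_scale[OF \<Phi>] by auto
  \<comment> \<open>\<open>ev\<close> applies to all multiples of \<open>f\<close>, and its right-hand side is at most \<open>norm \<eta>\<close>.\<close>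
  have re_null: "(\<lambda>n. re (blinfun_apply f (x n))) \<longlonglongrightarrow> 0" if f: "f \<in> ?M" for f
  proof (rule LIMSEQ_I)
    fix \<epsilon> :: real assume \<epsilon>: "0 < \<epsilon>"
    define r where "r = (norm \<eta> + 1) / \<epsilon>"
    have r: "0 < r" using \<epsilon> by (simp add: r_def add_nonneg_pos)
    have M: "s *\<^sub>R f \<in> ?M" for s using scaleM[OF f, of "of_real s"] by simp
    have "\<forall>\<^sub>F n in sequentially. norm (re (f (x n)) - 0) < \<epsilon>"
      using ev[OF M[of r]] ev[OF M[of "- r"]]
    proof eventually_elim
      case (elim n)
      have "re (\<eta> (x n)) \<le> norm \<eta>"
        using re_le_norm_blinfun[of \<eta> "x n"] mult_left_mono[OF x(1)[of n], of "norm \<eta>"] by simp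
      then have "r * \<bar>re (f (x n))\<bar> < norm \<eta> + 1"
        using elim d(1) r by (simp add: blinfun.scaleR_left blinfun.minus_left re_minus linear_scale[OF linear_re] abs_if)
      also have "\<dots> = r * \<epsilon>" using \<epsilon> by (simp add: r_def)
      finally show ?case using r by simp
    qed
    then show "\<exists>n0. \<forall>n\<ge>n0. norm (re (f (x n)) - 0) < \<epsilon>" by (simp add: eventually_sequentially)
  qed
  have null: "(\<lambda>n. blinfun_apply f (x n)) \<longlonglongrightarrow> 0" if f: "f \<in> ?M" for f
  proof -
    have "(\<lambda>n. of_real (re (f (x n))) - J * of_real (re (dual_scale J f (x n)))) \<longlonglongrightarrow> of_real 0 - J * of_real 0"
      by (intro tendsto_intros re_null f scaleM)
    moreover have "of_real (re (f (x n))) - J * of_real (re (dual_scale J f (x n))) = f (x n)" for n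
      using decomp[of "f (x n)"] by simp
    ultimately show ?thesis by simp
  qed
  define y where "y n = scl (inverse (\<eta> (x n))) (x n)" for n
  have y_apply: "f (y n) = f (x n) / \<eta> (x n)" if "f \<in> D" for f n
    using that by (simp add: y_def dual_iff field_simps)
  have norm_\<eta>: "\<forall>\<^sub>F n in sequentially. d \<le> norm (\<eta> (x n))"
    using \<eta>_ev
  proof eventually_elim
    case (elim n)
    then show ?case using abs_re_le[of "\<eta> (x n)"] by linarith
  qed
  have lim: "(\<lambda>n. blinfun_apply f (y n)) \<longlonglongrightarrow> \<Phi> f" if f: "f \<in> D" for f
  proof -
    \<comment> \<open>The dual is the sum of the kernel, where \<open>y\<close> tends to \<open>0\<close>, and the span of \<open>\<eta>\<close>, where \<open>\<eta> (y n) = 1\<close>.\<close>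
    define g where "g = f - dual_scale (\<Phi> f) \<eta>"
    have g: "g \<in> ?M"
      using f \<eta> by (simp add: g_def diff_in_dual dual_scale_in_dual dual_linear_diff[OF \<Phi>] dual_linear_scale[OF \<Phi>])
    have "(\<lambda>n. g (y n)) \<longlonglongrightarrow> 0"
    proof (rule Lim_null_comparison)
      show "\<forall>\<^sub>F n in sequentially. norm (g (y n)) \<le> norm (g (x n)) / d"
        using norm_\<eta>
      proof eventually_elim
        case (elim n)
        then show ?case using g d(1) by (auto simp: y_apply norm_divide intro!: divide_left_mono mult_pos_pos)
      qed
      show "(\<lambda>n. norm (g (x n)) / d) \<longlonglongrightarrow> 0"
        using tendsto_divide[OF tendsto_norm[OF null[OF g]] tendsto_const[of d]] d(1) by simp
    qed
    then have "(\<lambda>n. g (y n) + \<Phi> f) \<longlonglongrightarrow> 0 + \<Phi> f" by (intro tendsto_intros)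
    moreover have "\<forall>\<^sub>F n in sequentially. g (y n) + \<Phi> f = f (y n)"
      using norm_\<eta>
    proof eventually_elim
      case (elim n)
      then have "\<eta> (y n) = 1" using d(1) \<eta>(1) by (auto simp: y_apply)
      then show ?case by (simp add: g_def blinfun.diff_left)
    qed
    ultimately show ?thesis using tendsto_cong by force
  qed
  have "norm (\<Phi> f) \<le> (1 / d) * norm f" if f: "f \<in> D" for f
  proof (rule tendsto_upperbound[OF tendsto_norm[OF lim[OF f]]])
    show "\<forall>\<^sub>F n in sequentially. norm (f (y n)) \<le> (1 / d) * norm f"
      using norm_\<eta>
    proof eventually_elim
      case (elim n)
      have "norm (f (x n)) \<le> norm f"
        using norm_blinfun[of f "x n"] mult_left_mono[OF x(1)[of n], of "norm f"] by simp
      then have "norm (f (x n)) / norm (\<eta> (x n)) \<le> norm f / d"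
        using elim d(1) by (intro frac_le) auto
      then show ?case using f by (simp add: y_apply norm_divide)
    qed
  qed simp
  then have "restrict \<Phi> D \<in> bidual_space scl"
    unfolding bidual_iff using \<Phi> add_in_dual dual_scale_in_dual
    by (auto simp: dual_linear_def intro!: exI[of _ "1 / d"])
  then show ?thesis unfolding B1_iff using lim by auto
qed

lemma convex_kernel: "dual_linear \<Phi> \<Longrightarrow> convex {f \<in> D. \<Phi> f = 0}"
  by (auto intro!: convexI simp: add_in_dual scaleR_in_dual dual_linear_add dual_linear_scaleR)

lemma closedin_if_I_env_subset:
  assumes top: "topspace \<tau> = D" and env: "I_env scl A = \<tau> closure_of (convex hull A)"
    and A: "A \<subseteq> D" "convex A" "I_env scl A \<subseteq> A"
  shows "closedin \<tau> A"
  using assms closure_of_subset_eq[of A \<tau>] by (simp add: convex_hull_eq[THEN iffD2])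

text \<open>
  Together with \<open>\<phi>\<close> all its scalar multiples are weak* limits of sequences from \<open>X\<close>. The half-spaces of
  \<open>\<plusminus>\<phi>\<close> and \<open>\<plusminus>J\<phi>\<close> being closed, the real and the imaginary part of \<open>\<phi>\<close> are continuous.
\<close>
lemma continuous_functional_in_B1:
  assumes lc: "locally_convex_topology_on_dual scl \<tau>"
    and env: "\<And>A. A \<subseteq> D \<Longrightarrow> I_env scl A = \<tau> closure_of (convex hull A)"
    and \<phi>: "\<phi> \<in> B1 scl"
  shows "continuous_map \<tau> euclidean \<phi>"
proof -
  note top = locally_convex_topspace[OF lc]
  obtain C x where \<phi>: "dual_linear \<phi>" "\<And>f. f \<in> D \<Longrightarrow> norm (\<phi> f) \<le> C * norm f"
    "\<And>f. f \<in> D \<Longrightarrow> (\<lambda>n. blinfun_apply f (x n)) \<longlonglongrightarrow> \<phi> f"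
    using \<phi> unfolding B1_iff bidual_iff by blast
  have closed: "closedin \<tau> {f \<in> D. re (c * \<phi> f) \<le> r}" for c r
  proof (rule closedin_if_I_env_subset[OF top env])
    have lin: "dual_linear (\<lambda>f. c * \<phi> f)"
      using \<phi>(1) by (simp add: dual_linear_def algebra_simps)
    show "convex {f \<in> D. re (c * \<phi> f) \<le> r}" by (rule convex_halfspace_dual_linear[OF lin])
    show "I_env scl {f \<in> D. re (c * \<phi> f) \<le> r} \<subseteq> {f \<in> D. re (c * \<phi> f) \<le> r}"
    proof (rule I_env_halfspace_subset[OF lin, where C = "norm c * C" and x = "\<lambda>n. scl c (x n)"])
      show "norm (c * \<phi> f) \<le> norm c * C * norm f" if "f \<in> D" for f
        using mult_left_mono[OF \<phi>(2)[OF that], of "norm c"] by (simp add: norm_mult algebra_simps)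
      show "(\<lambda>n. blinfun_apply f (scl c (x n))) \<longlonglongrightarrow> c * \<phi> f" if "f \<in> D" for f
        using tendsto_mult_left[OF \<phi>(3)[OF that], of c] that by (simp add: dual_iff)
    qed
  qed auto
  have cont: "continuous_map \<tau> euclideanreal (\<lambda>f. re (c * \<phi> f))" for c
    unfolding continuous_map_upper_lower_semicontinuous_le
    using closed[of c] closed[of "- c" "- r" for r] by (simp add: top re_minus)
  have of_real: "continuous_map euclideanreal euclidean (of_real :: real \<Rightarrow> 'k)"
    by (auto intro!: continuous_intros)
  have times: "continuous_map euclidean euclidean (\<lambda>z. J * z)"
    by (auto intro!: continuous_intros)
  have 1: "continuous_map \<tau> euclidean (\<lambda>f. of_real (re (c * \<phi> f)) :: 'k)" for c
    using continuous_map_compose[OF cont of_real] by (simp add: comp_def)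
  have 2: "continuous_map \<tau> euclidean (\<lambda>f. J * of_real (re (J * \<phi> f)))"
    using continuous_map_compose[OF 1 times] by (simp add: comp_def)
  have "continuous_map \<tau> euclidean (\<lambda>f. of_real (re (1 * \<phi> f)) - J * of_real (re (J * \<phi> f)))"
    by (rule continuous_map_diff[OF 1 2])
  then show ?thesis
    by (rule continuous_map_eq) (use decomp in simp)
qed

text \<open>
  Assume (1). Continuity of the members of \<open>B\<^sub>1(X)\<close> makes \<open>\<tau>\<close> finer than \<open>\<sigma>(X\<^sup>*, B\<^sub>1(X))\<close>, which is one
  inclusion. For the other, a point outside the \<open>\<tau>\<close>-closed convex hull is separated by a \<open>\<tau>\<close>-continuous
  functional, and such a functional belongs to \<open>B\<^sub>1(X)\<close>.
\<close>
theorem I_env_locally_convex_iff_sigma_B1: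
  "(\<exists>\<tau>. locally_convex_topology_on_dual scl \<tau> \<and>
        (\<forall>A \<subseteq> D. I_env scl A = \<tau> closure_of (convex hull A)))
   \<longleftrightarrow> (\<forall>A \<subseteq> D. I_env scl A = sigma_dual scl (B1 scl) closure_of (convex hull A))"
proof
  assume "\<forall>A \<subseteq> D. I_env scl A = sigma_dual scl (B1 scl) closure_of (convex hull A)"
  moreover have "locally_convex_topology_on_dual scl (sigma_dual scl (B1 scl))"
    unfolding sigma_dual_def
    by (rule locally_convex_initial_topology) (auto simp: B1_iff bidual_iff)
  ultimately show "\<exists>\<tau>. locally_convex_topology_on_dual scl \<tau> \<and>
        (\<forall>A \<subseteq> D. I_env scl A = \<tau> closure_of (convex hull A))" by blast
next
  assume "\<exists>\<tau>. locally_convex_topology_on_dual scl \<tau> \<and>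
        (\<forall>A \<subseteq> D. I_env scl A = \<tau> closure_of (convex hull A))"
  then obtain \<tau> where lc: "locally_convex_topology_on_dual scl \<tau>"
    and env: "\<And>A. A \<subseteq> D \<Longrightarrow> I_env scl A = \<tau> closure_of (convex hull A)" by blast
  note top = locally_convex_topspace[OF lc]
  let ?\<sigma> = "sigma_dual scl (B1 scl)"
  have top\<sigma>: "topspace ?\<sigma> = D" by (simp add: sigma_dual_def)
  have coarser: "continuous_map \<tau> ?\<sigma> (\<lambda>f. f)"
    unfolding sigma_dual_def
    by (rule continuous_map_into_initial_topology) (auto simp: top intro: continuous_functional_in_B1[OF lc env])
  show "\<forall>A \<subseteq> D. I_env scl A = ?\<sigma> closure_of (convex hull A)"
  proof (intro allI impI equalityI)
    fix A assume A: "A \<subseteq> D"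
    show "I_env scl A \<subseteq> ?\<sigma> closure_of (convex hull A)"
      using continuous_map_image_closure_subset[OF coarser, of "convex hull A"] env[OF A] by simp
    show "?\<sigma> closure_of (convex hull A) \<subseteq> I_env scl A"
    proof
      fix \<eta> assume \<eta>: "\<eta> \<in> ?\<sigma> closure_of (convex hull A)"
      have "?\<sigma> closure_of (convex hull A) \<subseteq> D" using closure_of_subset_topspace[of ?\<sigma>] top\<sigma> by simp
      then have \<eta>D: "\<eta> \<in> D" using \<eta> by (rule subsetD)
      have "A \<noteq> {}"
      proof
        assume "A = {}"
        then show False using \<eta> by simp
      qed
      show "\<eta> \<in> I_env scl A"
      proof (rule ccontr)
        assume "\<eta> \<notin> I_env scl A"
        then obtain \<phi> V e where \<phi>: "linear \<phi>" "openin \<tau> V" "0 \<in> V" "\<And>v. v \<in> V \<Longrightarrow> \<phi> v \<le> (1::real)"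
          "0 < e" "\<And>a. a \<in> A \<Longrightarrow> \<phi> a + e \<le> \<phi> \<eta>"
          using separation_from_closed_convex_hull[OF lc A \<open>A \<noteq> {}\<close> \<eta>D] env[OF A] by metis
        define \<Phi> where "\<Phi> = extend dual_scale \<phi>"
        have \<Phi>: "dual_linear \<Phi>" "\<And>f. re (\<Phi> f) = \<phi> f"
          unfolding \<Phi>_def using \<phi>(1) by (simp_all add: dual_linear_extend re_extend_dual)
        have cont: "continuous_map \<tau> euclidean \<Phi>"
          unfolding \<Phi>_def by (intro continuous_extend lc continuous_if_bounded_above_on_nhd[OF lc \<phi>(1-4)])
        let ?M = "{f \<in> D. \<Phi> f = 0}"
        have "closedin \<tau> ?M"
          using closedin_continuous_map_preimage[OF cont, of "{0}"] top by simp
        then have M: "I_env scl ?M \<subseteq> ?M"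
          using env[of ?M] convex_kernel[OF \<Phi>(1)] by (simp add: convex_hull_eq[THEN iffD2] closure_of_closedin)
        obtain a where a: "a \<in> A" using \<open>A \<noteq> {}\<close> by blast
        have nz: "\<Phi> (\<eta> - a) \<noteq> 0"
        proof
          assume "\<Phi> (\<eta> - a) = 0"
          then have "\<phi> (\<eta> - a) = 0" using \<Phi>(2)[of "\<eta> - a"] by (simp add: re_zero)
          then show False using \<phi>(5) \<phi>(6)[OF a] by (simp add: linear_diff[OF \<phi>(1)])
        qed
        \<comment> \<open>A point outside the kernel, normalised as \<open>kernel_I_env_imp_B1\<close> requires.\<close>
        define \<zeta> where "\<zeta> = dual_scale (inverse (\<Phi> (\<eta> - a))) (\<eta> - a)"
        have "\<eta> - a \<in> D" using \<eta>D a A by (intro diff_in_dual) auto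
        then have \<zeta>: "\<zeta> \<in> D" "\<Phi> \<zeta> = 1"
          using nz by (auto simp: \<zeta>_def dual_scale_in_dual dual_linear_scale[OF \<Phi>(1)])
        then have "\<zeta> \<notin> I_env scl ?M" using M by auto
        then have B1: "restrict \<Phi> D \<in> B1 scl" by (rule kernel_I_env_imp_B1[OF \<Phi>(1) \<zeta>])
        have "?\<sigma> closure_of (convex hull A) \<subseteq> {f \<in> D. re (restrict \<Phi> D f) \<le> \<phi> \<eta> - e}"
        proof (rule closure_of_convex_hull_subset_halfspace[OF top\<sigma> _ _ A])
          show "dual_linear (restrict \<Phi> D)" using B1 by (simp add: B1_iff bidual_iff)
          show "continuous_map ?\<sigma> euclidean (restrict \<Phi> D)"
            unfolding sigma_dual_def by (rule continuous_map_initial_topology[OF B1])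
          show "re (restrict \<Phi> D f) \<le> \<phi> \<eta> - e" if "f \<in> A" for f
            using \<phi>(6)[OF that] \<Phi>(2)[of f] that A by (auto simp: subset_iff)
        qed
        then show False using \<eta> \<eta>D \<phi>(5) \<Phi>(2)[of \<eta>] by auto
      qed
    qed
  qed
qed

end

lemma scalar_banach_real: "scalar_banach ((*\<^sub>R) :: real \<Rightarrow> 'a::banach \<Rightarrow> 'a) (\<lambda>r. r) 0"
  unfolding scalar_banach_def real_part_def
  by (simp add: banach_space_over_scaleR linear_iff)

lemma scalar_banach_complex: "banach_space_over scl \<Longrightarrow> scalar_banach scl Re \<i>"
  unfolding scalar_banach_def real_part_def
  by (simp add: linear_iff abs_Re_le_cmod complex_eq_iff)

theorem proposition3p2:
  fixes scaleC :: "complex \<Rightarrow> 'b::banach \<Rightarrow> 'b"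
  shows
    "((\<exists>\<tau>. locally_convex_topology_on_dual ((*\<^sub>R) :: real \<Rightarrow> 'a::banach \<Rightarrow> 'a) \<tau> \<and>
           (\<forall>A \<subseteq> dual_space ((*\<^sub>R) :: real \<Rightarrow> 'a \<Rightarrow> 'a).
              I_env ((*\<^sub>R) :: real \<Rightarrow> 'a \<Rightarrow> 'a) A = \<tau> closure_of (convex hull A)))
      \<longleftrightarrow>
      (\<forall>A \<subseteq> dual_space ((*\<^sub>R) :: real \<Rightarrow> 'a \<Rightarrow> 'a).
         I_env ((*\<^sub>R) :: real \<Rightarrow> 'a \<Rightarrow> 'a) A =
           sigma_dual ((*\<^sub>R) :: real \<Rightarrow> 'a \<Rightarrow> 'a) (B1 (*\<^sub>R)) closure_of (convex hull A)))
     \<and>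
     (banach_space_over scaleC \<longrightarrow>
      ((\<exists>\<tau>. locally_convex_topology_on_dual scaleC \<tau> \<and>
            (\<forall>A \<subseteq> dual_space scaleC. I_env scaleC A = \<tau> closure_of (convex hull A)))
       \<longleftrightarrow>
       (\<forall>A \<subseteq> dual_space scaleC.
          I_env scaleC A = sigma_dual scaleC (B1 scaleC) closure_of (convex hull A))))"
  using scalar_banach.I_env_locally_convex_iff_sigma_B1[OF scalar_banach_real]
    scalar_banach.I_env_locally_convex_iff_sigma_B1[OF scalar_banach_complex[of scaleC]]
  by blast

end
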